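(* Let $L$ be a finite-dimensional Lie algebra over a field $\mathbb{F}$ of prime characteristic $p$, let $M$ be a finite-dimensional $L$-module, let $\mathfrak{L}$ be a $p$-envelope of $L$ with $\dim_{\mathbb{F}}\mathfrak{L}/L<\infty$, and let $n$ be a non-negative integer. Then $H^j(L,M)=0$ for every $0\le j\le n$ if and only if $H^j(\mathfrak{L},M)=0$ for every $0\le j\le n$. In particular, $H^{\bullet}(L,M)=0$ if and only if $H^{\bullet}(\mathfrak{L},M)=0$.
   Context: $H^n(\cdot,M)$ denotes ordinary (Chevalley-Eilenberg) Lie algebra cohomology, and $H^{\bullet}=0$ means that $H^n=0$ for every non-negative integer $n$. A $p$-envelope of a Lie algebra $L$ over a field of characteristic $p$ is a triple $(\mathfrak{L},(\cdot)^{[p]},\iota)$ where $\mathfrak{L}$ is a restricted Lie algebra with $p$-mapping $(\cdot)^{[p]}$ and $\iota:L\to\mathfrak{L}$ is an injective Lie algebra homomorphism such that the smallest restricted subalgebra ($p$-subalgebra) of $\mathfrak{L}$ containing $\iota(L)$ is $\mathfrak{L}$ itself; $L$ is identified with $\iota(L)$, and $\mathfrak{L}/L$ is the quotient vector space. Module structure: let $\hat L$ be the universal $p$-envelope of $L$, i.e. the restricted Lie subalgebra of the universal enveloping algebra $U(L)$ (with $p$-mapping $u\mapsto u^p$) generated by $L$, and $\hat\iota:L\to\hat L$ the inclusion. Every $L$-module $M$ is a $U(L)$-module, hence an $\hat L$-module. There exists a Lie algebra homomorphism $\phi:\mathfrak{L}\to\hat L$ with $\phi\circ\iota=\hat\iota$;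 fix any such $\phi$. Then $M$ is regarded as an $\mathfrak{L}$-module via $\phi$, extending the action of $L$. *)

theory Defs
  imports
    "HOL-Computational_Algebra.Polynomial"
    "HOL-Computational_Algebra.Primes"
    "HOL-Library.Poly_Mapping"
    "HOL-Library.Function_Algebras"
    "HOL-Algebra.QuotRing"
begin

section \<open>Quotients of vector spaces\<close>

definition coset :: "'v::ab_group_add set \<Rightarrow> 'v \<Rightarrow> 'v set" where
  "coset W x = {x + w | w. w \<in> W}"

definition quotient_space :: "'v::ab_group_add set \<Rightarrow> 'v set \<Rightarrow> 'v set set" where
  "quotient_space V W = coset W ` V"

definition finite_dimensional_quotient ::
    "('k::field \<Rightarrow> 'v::ab_group_add \<Rightarrow> 'v) \<Rightarrow> 'v set \<Rightarrow> 'v set \<Rightarrow> bool" where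
  "finite_dimensional_quotient scale V W \<longleftrightarrow>
     (\<exists>B. finite B \<and> B \<subseteq> V \<and>
          quotient_space V W = {coset W (\<Sum>b\<in>B. scale (c b) b) | c. True})"


section \<open>Lie algebras and Lie modules\<close>

locale lie_algebra = vector_space scale
  for scale :: "'k::field \<Rightarrow> 'a::ab_group_add \<Rightarrow> 'a" +
  fixes bracket :: "'a \<Rightarrow> 'a \<Rightarrow> 'a"
  assumes bracket_linear_right: "Vector_Spaces.linear scale scale (\<lambda>y. bracket x y)"
    and bracket_linear_left: "Vector_Spaces.linear scale scale (\<lambda>x. bracket x y)"
    and bracket_self: "bracket x x = 0"
    and jacobi: "bracket x (bracket y z) + bracket y (bracket z x) + bracket z (bracket x y) = 0"

locale lie_module = lie_algebra scale bracket + M: vector_space scaleM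
  for scale :: "'k::field \<Rightarrow> 'a::ab_group_add \<Rightarrow> 'a"
    and bracket :: "'a \<Rightarrow> 'a \<Rightarrow> 'a"
    and scaleM :: "'k \<Rightarrow> 'm::ab_group_add \<Rightarrow> 'm" +
  fixes act :: "'a \<Rightarrow> 'm \<Rightarrow> 'm"
  assumes act_linear_right: "Vector_Spaces.linear scaleM scaleM (\<lambda>m. act x m)"
    and act_linear_left: "Vector_Spaces.linear scale scaleM (\<lambda>x. act x m)"
    and act_bracket: "act (bracket x y) m = act x (act y m) - act y (act x m)"


section \<open>Chevalley--Eilenberg cohomology\<close>

text \<open>
  An \<open>n\<close>-cochain is an alternating \<open>n\<close>-linear map, encoded as a function on argument
  lists that is \<open>0\<close> outside the lists of length \<open>n\<close>. Alternating means vanishing on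
  lists with a repeated entry, as required in characteristic 2.
\<close>

definition cochains ::
    "('k::field \<Rightarrow> 'a::ab_group_add \<Rightarrow> 'a) \<Rightarrow> ('k \<Rightarrow> 'm::ab_group_add \<Rightarrow> 'm) \<Rightarrow>
     nat \<Rightarrow> ('a list \<Rightarrow> 'm) set" where
  "cochains scale scaleM n =
     {f. (\<forall>xs. length xs \<noteq> n \<longrightarrow> f xs = 0) \<and>
         (\<forall>xs i. length xs = n \<and> i < n \<longrightarrow>
            Vector_Spaces.linear scale scaleM (\<lambda>x. f (xs[i := x]))) \<and>
         (\<forall>xs i j. length xs = n \<and> i < j \<and> j < n \<and> xs ! i = xs ! j \<longrightarrow> f xs = 0)}"

text \<open>
  \<open>nths xs (- {i})\<close> and \<open>nths xs (- {i, j})\<close> are \<open>xs\<close> with the entries at the given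
  positions omitted, so this is
  \[ (d f)(x_0,\dots,x_n) = \sum_i (-1)^i x_i \cdot f(\dots,\widehat{x_i},\dots)
     + \sum_{i<j} (-1)^{i+j} f([x_i,x_j],\dots,\widehat{x_i},\dots,\widehat{x_j},\dots). \]
\<close>

definition coboundary ::
    "('a \<Rightarrow> 'a \<Rightarrow> 'a) \<Rightarrow> ('k::field \<Rightarrow> 'm::ab_group_add \<Rightarrow> 'm) \<Rightarrow> ('a \<Rightarrow> 'm \<Rightarrow> 'm) \<Rightarrow>
     nat \<Rightarrow> ('a list \<Rightarrow> 'm) \<Rightarrow> 'a list \<Rightarrow> 'm" where
  "coboundary bracket scaleM act n f xs =
     (if length xs = Suc n then
        (\<Sum>i\<le>n. scaleM ((- 1) ^ i) (act (xs ! i) (f (nths xs (- {i}))))) +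
        (\<Sum>j\<le>n. \<Sum>i<j. scaleM ((- 1) ^ (i + j))
            (f (bracket (xs ! i) (xs ! j) # nths xs (- {i, j}))))
      else 0)"

definition cocycles ::
    "('k::field \<Rightarrow> 'a::ab_group_add \<Rightarrow> 'a) \<Rightarrow> ('a \<Rightarrow> 'a \<Rightarrow> 'a) \<Rightarrow>
     ('k \<Rightarrow> 'm::ab_group_add \<Rightarrow> 'm) \<Rightarrow> ('a \<Rightarrow> 'm \<Rightarrow> 'm) \<Rightarrow> nat \<Rightarrow> ('a list \<Rightarrow> 'm) set" where
  "cocycles scale bracket scaleM act n =
     {f \<in> cochains scale scaleM n. coboundary bracket scaleM act n f = 0}"

definition coboundaries ::
    "('k::field \<Rightarrow> 'a::ab_group_add \<Rightarrow> 'a) \<Rightarrow> ('a \<Rightarrow> 'a \<Rightarrow> 'a) \<Rightarrow>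
     ('k \<Rightarrow> 'm::ab_group_add \<Rightarrow> 'm) \<Rightarrow> ('a \<Rightarrow> 'm \<Rightarrow> 'm) \<Rightarrow> nat \<Rightarrow> ('a list \<Rightarrow> 'm) set" where
  "coboundaries scale bracket scaleM act n =
     (case n of 0 \<Rightarrow> {0}
      | Suc k \<Rightarrow> coboundary bracket scaleM act k ` cochains scale scaleM k)"

definition cohomology ::
    "('k::field \<Rightarrow> 'a::ab_group_add \<Rightarrow> 'a) \<Rightarrow> ('a \<Rightarrow> 'a \<Rightarrow> 'a) \<Rightarrow>
     ('k \<Rightarrow> 'm::ab_group_add \<Rightarrow> 'm) \<Rightarrow> ('a \<Rightarrow> 'm \<Rightarrow> 'm) \<Rightarrow> nat \<Rightarrow> ('a list \<Rightarrow> 'm) set set" where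
  "cohomology scale bracket scaleM act n =
     quotient_space (cocycles scale bracket scaleM act n) (coboundaries scale bracket scaleM act n)"

definition cohomology_vanishes ::
    "('k::field \<Rightarrow> 'a::ab_group_add \<Rightarrow> 'a) \<Rightarrow> ('a \<Rightarrow> 'a \<Rightarrow> 'a) \<Rightarrow>
     ('k \<Rightarrow> 'm::ab_group_add \<Rightarrow> 'm) \<Rightarrow> ('a \<Rightarrow> 'm \<Rightarrow> 'm) \<Rightarrow> nat \<Rightarrow> bool" where
  "cohomology_vanishes scale bracket scaleM act n \<longleftrightarrow>
     cohomology scale bracket scaleM act n = {coset (coboundaries scale bracket scaleM act n) 0}"


section \<open>Restricted Lie algebras and p-envelopes\<close>

text \<open>
  The map \<open>ad (x \<otimes> X + y \<otimes> 1)\<close> on the extension of the Lie algebra by polynomials in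
  the indeterminate \<open>X\<close>; elements of the extension are polynomials with coefficients
  in the Lie algebra.
\<close>

definition ad_poly :: "('a::ab_group_add \<Rightarrow> 'a \<Rightarrow> 'a) \<Rightarrow> 'a \<Rightarrow> 'a \<Rightarrow> 'a poly \<Rightarrow> 'a poly" where
  "ad_poly bracket x y q = pCons 0 (map_poly (bracket x) q) + map_poly (bracket y) q"

text \<open>
  Jacobson's elements \<open>s\<^sub>i(x, y)\<close>, determined for \<open>1 \<le> i \<le> p - 1\<close> by
  \[ (\mathrm{ad}(x \otimes X + y \otimes 1))^{p-1}(x \otimes 1)
     = \sum_{i=1}^{p-1} i\, s_i(x,y) \otimes X^{i-1}. \]
\<close>

definition jacobson_s ::
    "('k::field \<Rightarrow> 'a::ab_group_add \<Rightarrow> 'a) \<Rightarrow> ('a \<Rightarrow> 'a \<Rightarrow> 'a) \<Rightarrow> nat \<Rightarrow> nat \<Rightarrow> 'a \<Rightarrow> 'a \<Rightarrow> 'a" where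
  "jacobson_s scale bracket p i x y =
     scale (inverse (of_nat i)) (coeff ((ad_poly bracket x y ^^ (p - 1)) [:x:]) (i - 1))"

locale restricted_lie_algebra = lie_algebra scale bracket
  for scale :: "'k::field \<Rightarrow> 'a::ab_group_add \<Rightarrow> 'a"
    and bracket :: "'a \<Rightarrow> 'a \<Rightarrow> 'a" +
  fixes p :: nat and pmap :: "'a \<Rightarrow> 'a"
  assumes prime_p: "prime p" and char_p: "CHAR('k) = p"
    and pmap_scale: "pmap (scale c x) = scale (c ^ p) (pmap x)"
    and pmap_ad: "bracket (pmap x) = bracket x ^^ p"
    and pmap_add: "pmap (x + y) = pmap x + pmap y + (\<Sum>i = 1..p - 1. jacobson_s scale bracket p i x y)"

definition p_subalgebra ::
    "('k::field \<Rightarrow> 'a::ab_group_add \<Rightarrow> 'a) \<Rightarrow> ('a \<Rightarrow> 'a \<Rightarrow> 'a) \<Rightarrow> ('a \<Rightarrow> 'a) \<Rightarrow> 'a set \<Rightarrow> bool" where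
  "p_subalgebra scale bracket pmap S \<longleftrightarrow>
     module.subspace scale S \<and> (\<forall>x\<in>S. \<forall>y\<in>S. bracket x y \<in> S) \<and> (\<forall>x\<in>S. pmap x \<in> S)"

locale p_envelope =
  L: lie_algebra scaleL bracketL + restricted_lie_algebra scaleE bracketE p pmap
  for scaleL :: "'k::field \<Rightarrow> 'a::ab_group_add \<Rightarrow> 'a" and bracketL :: "'a \<Rightarrow> 'a \<Rightarrow> 'a"
    and scaleE :: "'k \<Rightarrow> 'e::ab_group_add \<Rightarrow> 'e" and bracketE :: "'e \<Rightarrow> 'e \<Rightarrow> 'e"
    and p :: nat and pmap :: "'e \<Rightarrow> 'e" +
  fixes \<iota> :: "'a \<Rightarrow> 'e"
  assumes iota_linear: "Vector_Spaces.linear scaleL scaleE \<iota>"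
    and iota_bracket: "\<iota> (bracketL x y) = bracketE (\<iota> x) (\<iota> y)"
    and iota_inj: "inj \<iota>"
    and iota_generates: "\<Inter> {S. p_subalgebra scaleE bracketE pmap S \<and> range \<iota> \<subseteq> S} = UNIV"


section \<open>The universal enveloping algebra\<close>

text \<open>
  The free associative algebra on a set of letters is the monoid algebra of the free
  monoid, whose operation is written additively to match the product of
  \<^type>\<open>poly_mapping\<close>.
\<close>

datatype 'a fword = FWord (letters: "'a list")

instantiation fword :: (type) monoid_add
begin

definition zero_fword :: "'a fword" where "zero_fword = FWord []"

definition plus_fword :: "'a fword \<Rightarrow> 'a fword \<Rightarrow> 'a fword" where
  "plus_fword v w = FWord (letters v @ letters w)"

instance
  by standard (simp_all add: zero_fword_def plus_fword_def)

end

type_synonym ('a, 'k) free_alg = "'a fword \<Rightarrow>\<^sub>0 'k"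

definition gen :: "'a \<Rightarrow> ('a, 'k::field) free_alg" where
  "gen x = Poly_Mapping.single (FWord [x]) 1"

definition const :: "'k::field \<Rightarrow> ('a, 'k) free_alg" where
  "const c = Poly_Mapping.single 0 c"

definition free_alg_ring :: "('a, 'k::field) free_alg ring" where
  "free_alg_ring = \<lparr>carrier = UNIV, mult = (*), one = 1, zero = 0, add = (+)\<rparr>"

text \<open>
  The letters are all elements of the Lie algebra, so besides the commutator relations
  the linear relations are needed; dividing by the latter alone gives the tensor algebra.
\<close>

definition enveloping_relations ::
    "('k::field \<Rightarrow> 'a::ab_group_add \<Rightarrow> 'a) \<Rightarrow> ('a \<Rightarrow> 'a \<Rightarrow> 'a) \<Rightarrow> ('a, 'k) free_alg set" where
  "enveloping_relations scale bracket =
     {gen (x + y) - (gen x + gen y) | x y. True} \<union>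
     {gen (scale c x) - const c * gen x | c x. True} \<union>
     {gen x * gen y - gen y * gen x - gen (bracket x y) | x y. True}"

definition enveloping_ideal ::
    "('k::field \<Rightarrow> 'a::ab_group_add \<Rightarrow> 'a) \<Rightarrow> ('a \<Rightarrow> 'a \<Rightarrow> 'a) \<Rightarrow> ('a, 'k) free_alg set" where
  "enveloping_ideal scale bracket = genideal free_alg_ring (enveloping_relations scale bracket)"

definition UEA ::
    "('k::field \<Rightarrow> 'a::ab_group_add \<Rightarrow> 'a) \<Rightarrow> ('a \<Rightarrow> 'a \<Rightarrow> 'a) \<Rightarrow> ('a, 'k) free_alg set ring" where
  "UEA scale bracket = FactRing free_alg_ring (enveloping_ideal scale bracket)"

definition UEA_class ::
    "('k::field \<Rightarrow> 'a::ab_group_add \<Rightarrow> 'a) \<Rightarrow> ('a \<Rightarrow> 'a \<Rightarrow> 'a) \<Rightarrow>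
     ('a, 'k) free_alg \<Rightarrow> ('a, 'k) free_alg set" where
  "UEA_class scale bracket a = a_r_coset free_alg_ring (enveloping_ideal scale bracket) a"

definition UEA_scale ::
    "('k::field \<Rightarrow> 'a::ab_group_add \<Rightarrow> 'a) \<Rightarrow> ('a \<Rightarrow> 'a \<Rightarrow> 'a) \<Rightarrow>
     'k \<Rightarrow> ('a, 'k) free_alg set \<Rightarrow> ('a, 'k) free_alg set" where
  "UEA_scale scale bracket c u =
     UEA_class scale bracket (const c) \<otimes>\<^bsub>UEA scale bracket\<^esub> u"

definition UEA_commutator ::
    "('k::field \<Rightarrow> 'a::ab_group_add \<Rightarrow> 'a) \<Rightarrow> ('a \<Rightarrow> 'a \<Rightarrow> 'a) \<Rightarrow>
     ('a, 'k) free_alg set \<Rightarrow> ('a, 'k) free_alg set \<Rightarrow> ('a, 'k) free_alg set" where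
  "UEA_commutator scale bracket u v =
     (u \<otimes>\<^bsub>UEA scale bracket\<^esub> v) \<ominus>\<^bsub>UEA scale bracket\<^esub> (v \<otimes>\<^bsub>UEA scale bracket\<^esub> u)"

definition UEA_incl ::
    "('k::field \<Rightarrow> 'a::ab_group_add \<Rightarrow> 'a) \<Rightarrow> ('a \<Rightarrow> 'a \<Rightarrow> 'a) \<Rightarrow> 'a \<Rightarrow> ('a, 'k) free_alg set" where
  "UEA_incl scale bracket x = UEA_class scale bracket (gen x)"

definition UEA_p_subalgebra ::
    "('k::field \<Rightarrow> 'a::ab_group_add \<Rightarrow> 'a) \<Rightarrow> ('a \<Rightarrow> 'a \<Rightarrow> 'a) \<Rightarrow> nat \<Rightarrow>
     ('a, 'k) free_alg set set \<Rightarrow> bool" where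
  "UEA_p_subalgebra scale bracket p S \<longleftrightarrow>
     S \<subseteq> carrier (UEA scale bracket) \<and> \<zero>\<^bsub>UEA scale bracket\<^esub> \<in> S \<and>
     (\<forall>u\<in>S. \<forall>v\<in>S. u \<oplus>\<^bsub>UEA scale bracket\<^esub> v \<in> S) \<and>
     (\<forall>c. \<forall>u\<in>S. UEA_scale scale bracket c u \<in> S) \<and>
     (\<forall>u\<in>S. \<forall>v\<in>S. UEA_commutator scale bracket u v \<in> S) \<and>
     (\<forall>u\<in>S. u [^]\<^bsub>UEA scale bracket\<^esub> p \<in> S)"

definition universal_p_envelope ::
    "('k::field \<Rightarrow> 'a::ab_group_add \<Rightarrow> 'a) \<Rightarrow> ('a \<Rightarrow> 'a \<Rightarrow> 'a) \<Rightarrow> nat \<Rightarrow>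
     ('a, 'k) free_alg set set" where
  "universal_p_envelope scale bracket p =
     \<Inter> {S. UEA_p_subalgebra scale bracket p S \<and> range (UEA_incl scale bracket) \<subseteq> S}"

text \<open>Lie algebra homomorphisms from a p-envelope to the universal one extending the inclusion.\<close>

locale envelope_comparison = p_envelope scaleL bracketL scaleE bracketE p pmap \<iota>
  for scaleL :: "'k::field \<Rightarrow> 'a::ab_group_add \<Rightarrow> 'a" and bracketL :: "'a \<Rightarrow> 'a \<Rightarrow> 'a"
    and scaleE :: "'k \<Rightarrow> 'e::ab_group_add \<Rightarrow> 'e" and bracketE :: "'e \<Rightarrow> 'e \<Rightarrow> 'e"
    and p :: nat and pmap :: "'e \<Rightarrow> 'e" and \<iota> :: "'a \<Rightarrow> 'e" +
  fixes \<phi> :: "'e \<Rightarrow> ('a, 'k) free_alg set"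
  assumes phi_range: "\<phi> z \<in> universal_p_envelope scaleL bracketL p"
    and phi_add: "\<phi> (z + w) = \<phi> z \<oplus>\<^bsub>UEA scaleL bracketL\<^esub> \<phi> w"
    and phi_scale: "\<phi> (scaleE c z) = UEA_scale scaleL bracketL c (\<phi> z)"
    and phi_bracket: "\<phi> (bracketE z w) = UEA_commutator scaleL bracketL (\<phi> z) (\<phi> w)"
    and phi_iota: "\<phi> (\<iota> x) = UEA_incl scaleL bracketL x"

definition free_alg_action ::
    "('k::field \<Rightarrow> 'm::ab_group_add \<Rightarrow> 'm) \<Rightarrow> ('a \<Rightarrow> 'm \<Rightarrow> 'm) \<Rightarrow> ('a, 'k) free_alg \<Rightarrow> 'm \<Rightarrow> 'm" where
  "free_alg_action scaleM act a m =
     (\<Sum>w\<in>Poly_Mapping.keys a. scaleM (Poly_Mapping.lookup a w) (foldr act (letters w) m))"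

text \<open>
  The action of the enveloping algebra: for a Lie module, all representatives of a coset
  act in the same way.
\<close>

definition UEA_action ::
    "('k::field \<Rightarrow> 'm::ab_group_add \<Rightarrow> 'm) \<Rightarrow> ('a \<Rightarrow> 'm \<Rightarrow> 'm) \<Rightarrow>
     ('a, 'k) free_alg set \<Rightarrow> 'm \<Rightarrow> 'm" where
  "UEA_action scaleM act u m = (THE v. \<forall>a\<in>u. free_alg_action scaleM act a m = v)"

definition envelope_action ::
    "('k::field \<Rightarrow> 'm::ab_group_add \<Rightarrow> 'm) \<Rightarrow> ('a \<Rightarrow> 'm \<Rightarrow> 'm) \<Rightarrow>
     ('e \<Rightarrow> ('a, 'k) free_alg set) \<Rightarrow> 'e \<Rightarrow> 'm \<Rightarrow> 'm" where
  "envelope_action scaleM act \<phi> z m = UEA_action scaleM act (\<phi> z) m"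

end

theory Submission
  imports Defs
begin

text \<open>
  Write \<open>E\<close> for the \<open>p\<close>-envelope and \<open>I\<close> for the image of \<open>L\<close>. Since \<open>ad (x\<^sup>[\<^sup>p\<^sup>]) = (ad x)\<^sup>p\<close>, the
  ideal \<open>I\<close> contains \<open>[E, E]\<close>, so every subspace between \<open>I\<close> and \<open>E\<close> is an ideal and \<open>E\<close> is
  reached from \<open>I\<close> by finitely many extensions \<open>S \<subseteq> T = S + k z\<close> of codimension one. Such an
  extension has a long exact sequence
  \[ \dots \to H^{j-1}(S,M) \to H^j(T,M) \to H^j(S,M) \to H^j(S,M) \to \dots \]
  whose last map is the Lie derivative \<open>\<theta>\<^sub>z\<close>. If \<open>\<theta>\<^sub>z\<close> is zero on \<open>H\<^sup>j(S, M)\<close>, then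
  \<open>H\<^sup>j(T, M)\<close> vanishes iff \<open>H\<^sup>j(S, M)\<close> and \<open>H\<^sup>j\<^sup>-\<^sup>1(S, M)\<close> do, which gives the theorem.

  To see that \<open>\<theta>\<^sub>z = 0\<close>, consider pairs of \<open>u \<in> U(L)\<close> and \<open>w \<in> E\<close> such that \<open>u\<close> and \<open>w\<close> have the same
  commutators and the operator on cochains built from the action of \<open>u\<close> on \<open>M\<close> and of \<open>ad w\<close> on the
  arguments is zero in cohomology. The pairs \<open>(x, x)\<close> with \<open>x \<in> L\<close> qualify by Cartan's formula, and as
  the \<open>p\<close>-th power of the operator of \<open>(u, w)\<close> is that of \<open>(u\<^sup>p, w\<^sup>[\<^sup>p\<^sup>])\<close>, the first components
  exhaust the universal \<open>p\<close>-envelope. For \<open>u = \<phi>(z)\<close>, the injectivity of \<open>L \<rightarrow> U(L)\<close> (the part of the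
  Poincare--Birkhoff--Witt theorem that is needed) shows that \<open>z - w\<close> centralizes \<open>I\<close>, hence \<open>E\<close>,
  so the operator of \<open>(u, w)\<close> is \<open>\<theta>\<^sub>z\<close>.
\<close>

section \<open>Cochains and the Cartan calculus\<close>

text \<open>The interior product with \<open>x\<close>; inductions on the degree of a form run
  through it.\<close>

definition contract :: "'a \<Rightarrow> ('a list \<Rightarrow> 'm) \<Rightarrow> 'a list \<Rightarrow> 'm" where
  "contract x f xs = f (x # xs)"

text \<open>The Lie derivative with a coefficient operator \<open>a\<close> and an argument operator
  \<open>D\<close>. They are separate because the pairs used later, such as p-th powers, need not
  come from a single Lie algebra element.\<close>

definition lie_der :: "('m::ab_group_add \<Rightarrow> 'm) \<Rightarrow> ('a \<Rightarrow> 'a) \<Rightarrow> ('a list \<Rightarrow> 'm) \<Rightarrow> 'a list \<Rightarrow> 'm" where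
  "lie_der a D f xs = a (f xs) - (\<Sum>i<length xs. f (xs[i := D (xs ! i)]))"

lemma lie_der_Nil [simp]: "lie_der a D f [] = a (f [])"
  by (simp add: lie_der_def)

text \<open>The commutation rule of Lie derivative and interior product, in the form of a recursion
  on the argument list.\<close>

lemma lie_der_Cons: "lie_der a D f (x # xs) = lie_der a D (contract x f) xs - f (D x # xs)"
  by (simp add: lie_der_def contract_def sum.lessThan_Suc_shift del: sum.lessThan_Suc)

lemma lie_der_Cons_explicit:
  "lie_der a D f (x # xs) =
     a (f (x # xs)) - (\<Sum>i<length xs. f (x # xs[i := D (xs ! i)])) - f (D x # xs)"
  by (simp add: lie_der_Cons) (simp add: lie_der_def contract_def)

lemma lie_der_diff:
  assumes "\<And>u v. a (u - v) = a u - a v"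
  shows "lie_der a D (f - g) = lie_der a D f - lie_der a D g"
  by (rule ext) (simp add: lie_der_def assms sum_subtractf)

lemma contract_add: "contract x (f + g) = contract x f + contract x g"
  by (rule ext) (simp add: contract_def)

section \<open>Alternating multilinear forms and their Lie derivatives\<close>

context vector_space_pair
begin

lemma linear_iff:
  "Vector_Spaces.linear s1 s2 f \<longleftrightarrow> (\<forall>x y. f (x + y) = f x + f y) \<and> (\<forall>c x. f (s1 c x) = s2 c (f x))"
  unfolding Vector_Spaces.linear_iff
  using vs1.vector_space_axioms vs2.vector_space_axioms by auto

text \<open>Splittings of the list suit recursion better than indices and updates. They carry no
  length condition because a cochain vanishes on lists of any other length.\<close>

lemma cochains_iff:
  "f \<in> cochains s1 s2 n \<longleftrightarrow> (\<forall>xs. length xs \<noteq> n \<longrightarrow> f xs = 0) \<and>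
     (\<forall>us vs. Vector_Spaces.linear s1 s2 (\<lambda>x. f (us @ x # vs))) \<and>
     (\<forall>us x vs ws. f (us @ x # vs @ x # ws) = 0)" (is "_ \<longleftrightarrow> ?s \<and> ?l \<and> ?a")
proof
  assume f: "f \<in> cochains s1 s2 n"
  then have s: ?s
    and l: "\<And>xs i. length xs = n \<Longrightarrow> i < n \<Longrightarrow> Vector_Spaces.linear s1 s2 (\<lambda>x. f (xs[i := x]))"
    and a: "\<And>xs i j. length xs = n \<Longrightarrow> i < j \<Longrightarrow> j < n \<Longrightarrow> xs ! i = xs ! j \<Longrightarrow> f xs = 0"
    unfolding cochains_def by blast+
  have "Vector_Spaces.linear s1 s2 (\<lambda>x. f (us @ x # vs))" for us vs
  proof (cases "length (us @ 0 # vs) = n")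
    case True
    then show ?thesis using l[of "us @ 0 # vs" "length us"] by simp
  next
    case False
    then have "f (us @ x # vs) = 0" for x using s by simp
    then show ?thesis by (simp add: linear_iff)
  qed
  moreover have "f (us @ x # vs @ x # ws) = 0" for us x vs ws
  proof (cases "length (us @ x # vs @ x # ws) = n")
    case True
    then show ?thesis
      by (intro a[of _ "length us" "length us + Suc (length vs)"]) (auto simp: nth_append)
  next
    case False
    then show ?thesis using s by blast
  qed
  ultimately show "?s \<and> ?l \<and> ?a" using s by blast
next
  assume h: "?s \<and> ?l \<and> ?a"
  have "Vector_Spaces.linear s1 s2 (\<lambda>x. f (xs[i := x]))" if "i < length xs" for xs i
    using h that by (simp add: upd_conv_take_nth_drop)
  moreover have "f xs = 0" if "length xs = n" "i < j" "j < n" "xs ! i = xs ! j" for xs i j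
  proof -
    \<comment> \<open>\<open>k\<close> counts the entries strictly between the two equal
      ones.\<close>
    define k where "k = j - Suc i"
    have "drop (Suc i) xs = take k (drop (Suc i) xs) @ xs ! j # drop (Suc k) (drop (Suc i) xs)"
      using id_take_nth_drop[of k "drop (Suc i) xs"] that by (simp add: k_def)
    then have "xs = take i xs @ xs ! i # take k (drop (Suc i) xs) @ xs ! i # drop (Suc k) (drop (Suc i) xs)"
      using id_take_nth_drop[of i xs] that by simp
    then show ?thesis using h by metis
  qed
  ultimately show "f \<in> cochains s1 s2 n" using h unfolding cochains_def by blast
qed

lemma cochain_length: "f \<in> cochains s1 s2 n \<Longrightarrow> length xs \<noteq> n \<Longrightarrow> f xs = 0"
  and cochain_linear: "f \<in> cochains s1 s2 n \<Longrightarrow> Vector_Spaces.linear s1 s2 (\<lambda>x. f (us @ x # vs))"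
  and cochain_alternating: "f \<in> cochains s1 s2 n \<Longrightarrow> f (us @ x # vs @ x # ws) = 0"
  by (simp_all add: cochains_iff)

lemma cochain_add: "f \<in> cochains s1 s2 n \<Longrightarrow> f (us @ (x + y) # vs) = f (us @ x # vs) + f (us @ y # vs)"
  and cochain_scale: "f \<in> cochains s1 s2 n \<Longrightarrow> f (us @ s1 c x # vs) = s2 c (f (us @ x # vs))"
  using cochain_linear[of f n us vs] by (auto simp: linear_iff)

lemma cochain_add_Cons: "f \<in> cochains s1 s2 n \<Longrightarrow> f ((x + y) # vs) = f (x # vs) + f (y # vs)"
  and cochain_scale_Cons: "f \<in> cochains s1 s2 n \<Longrightarrow> f (s1 c x # vs) = s2 c (f (x # vs))"
  and cochain_alternating_Cons: "f \<in> cochains s1 s2 n \<Longrightarrow> f (x # x # vs) = 0"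
  using cochain_add[of f n "[]" x y vs] cochain_scale[of f n "[]" c x vs]
    cochain_alternating[of f n "[]" x "[]" vs] by simp_all

text \<open>Expanding at \<open>x + y\<close> turns vanishing on equal neighbours into a sign change
  under neighbour swaps, and such swaps bring distant equal entries together. This is valid in
  characteristic 2 as well.\<close>

lemma cochainsI_adjacent:
  assumes s: "\<And>xs. length xs \<noteq> n \<Longrightarrow> f xs = 0"
    and l: "\<And>us vs. Vector_Spaces.linear s1 s2 (\<lambda>x. f (us @ x # vs))"
    and a: "\<And>us x ws. f (us @ x # x # ws) = 0"
  shows "f \<in> cochains s1 s2 n"
proof -
  have add: "f (us @ (x + y) # vs) = f (us @ x # vs) + f (us @ y # vs)" for us x y vs
    using l[of us vs] by (auto simp: linear_iff)
  have swap: "f (us @ x # y # ws) = - f (us @ y # x # ws)" for us x y ws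
  proof -
    have "0 = f (us @ (x + y) # (x + y) # ws)" by (simp add: a)
    also have "\<dots> = f (us @ x # (x + y) # ws) + f (us @ y # (x + y) # ws)" by (rule add)
    also have "\<dots> = f (us @ x # y # ws) + f (us @ y # x # ws)"
      using add[of "us @ [x]" x y ws] add[of "us @ [y]" x y ws] by (simp add: a)
    finally show ?thesis by (simp add: eq_neg_iff_add_eq_0)
  qed
  have "f (us @ x # vs @ x # ws) = 0" for us x vs ws
  proof (induction vs arbitrary: us)
    case (Cons v vs)
    then show ?case using Cons[of "us @ [v]"] swap[of us x v "vs @ x # ws"] by simp
  qed (simp add: a)
  then show ?thesis using s l by (simp add: cochains_iff)
qed

lemma cochain_swap:
  assumes "f \<in> cochains s1 s2 n"
  shows "f (x # y # vs) = - f (y # x # vs)"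
proof -
  have "0 = f ((x + y) # (x + y) # vs)" using assms by (simp add: cochain_alternating_Cons)
  also have "\<dots> = f (x # y # vs) + f (y # x # vs)"
    using cochain_add[OF assms, of "[x]" x y vs] cochain_add[OF assms, of "[y]" x y vs] assms
    by (simp add: cochain_add_Cons cochain_alternating_Cons)
  finally show ?thesis by (simp add: eq_neg_iff_add_eq_0)
qed

lemma cochain_contract:
  assumes "f \<in> cochains s1 s2 (Suc n)"
  shows "contract x f \<in> cochains s1 s2 n"
  using assms unfolding cochains_iff contract_def
  by (auto simp flip: append_Cons)

lemma cochain_contract_pred:
  assumes "f \<in> cochains s1 s2 n"
  shows "contract x f \<in> cochains s1 s2 (n - 1)"
proof (cases n)
  case 0
  then have "contract x f = 0" using assms by (auto simp: contract_def cochains_iff)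
  then show ?thesis by (simp add: cochains_iff linear_iff)
qed (use assms cochain_contract in auto)

text \<open>Linearity and alternation in the later places are inherited from the contractions, so
  only the first slot and the first two entries remain.\<close>

lemma cochain_SucI:
  assumes c: "\<And>x. contract x f \<in> cochains s1 s2 n" and nil: "f [] = 0"
    and l: "\<And>vs. Vector_Spaces.linear s1 s2 (\<lambda>x. f (x # vs))" and a: "\<And>x vs. f (x # x # vs) = 0"
  shows "f \<in> cochains s1 s2 (Suc n)"
proof (rule cochainsI_adjacent)
  have cons: "f (x # xs) = contract x f xs" for x xs by (simp add: contract_def)
  show "f xs = 0" if "length xs \<noteq> Suc n" for xs
    using that nil by (cases xs) (auto simp: cons cochain_length[OF c])
  show "Vector_Spaces.linear s1 s2 (\<lambda>x. f (us @ x # vs))" for us vs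
  proof (cases us)
    case (Cons u us')
    then show ?thesis using cochain_linear[OF c[of u], of us' vs] by (simp add: cons)
  qed (simp add: l)
  show "f (us @ x # x # ws) = 0" for us x ws
  proof (cases us)
    case (Cons u us')
    then show ?thesis using cochain_alternating[OF c[of u], of us' x "[]" ws] by (simp add: cons)
  qed (simp add: a)
qed

lemma cochain_move_front:
  assumes "f \<in> cochains s1 s2 n"
  shows "f (us @ x # vs) = s2 ((- 1) ^ length us) (f (x # us @ vs))"
  using assms
proof (induction us arbitrary: f n)
  case (Cons u us)
  have "f ((u # us) @ x # vs) = contract u f (us @ x # vs)" by (simp add: contract_def)
  also have "\<dots> = s2 ((- 1) ^ length us) (f (u # x # us @ vs))"
    using Cons.IH[OF cochain_contract_pred[OF Cons.prems, of u]] by (simp add: contract_def)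
  also have "\<dots> = s2 ((- 1) ^ length us) (- f (x # u # us @ vs))"
    by (subst cochain_swap[OF Cons.prems]) (rule refl)
  finally show ?case by simp
qed simp

lemma cochains_zero: "0 \<in> cochains s1 s2 n"
  by (simp add: cochains_iff linear_iff)

lemma cochains_add: "f \<in> cochains s1 s2 n \<Longrightarrow> g \<in> cochains s1 s2 n \<Longrightarrow> f + g \<in> cochains s1 s2 n"
  by (simp add: cochains_iff linear_iff vs2.scale_right_distrib)

lemma cochains_scale: "f \<in> cochains s1 s2 n \<Longrightarrow> (\<lambda>xs. s2 c (f xs)) \<in> cochains s1 s2 n"
  by (simp add: cochains_iff linear_iff vs2.scale_right_distrib vs2.scale_left_commute)

lemma cochains_diff: "f \<in> cochains s1 s2 n \<Longrightarrow> g \<in> cochains s1 s2 n \<Longrightarrow> f - g \<in> cochains s1 s2 n"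
  by (simp add: cochains_iff linear_iff vs2.scale_right_diff_distrib)

lemma cochain_lie_der:
  assumes "f \<in> cochains s1 s2 n" and a: "Vector_Spaces.linear s2 s2 a" and D: "Vector_Spaces.linear s1 s1 D"
  shows "lie_der a D f \<in> cochains s1 s2 n"
  using assms(1)
proof (induction n arbitrary: f)
  case 0
  interpret a: Vector_Spaces.linear s2 s2 a by (rule a)
  have "lie_der a D f xs = 0" if "length xs > 0" for xs
    using 0 that by (simp add: lie_der_def cochain_length[OF 0] a.zero)
  then have "lie_der a D f (us @ x # vs) = 0" for us x vs
    by simp
  then show ?case
    using \<open>\<And>xs. length xs > 0 \<Longrightarrow> lie_der a D f xs = 0\<close> by (auto simp: cochains_iff linear_iff)
next
  case (Suc n)
  interpret a: Vector_Spaces.linear s2 s2 a by (rule a)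
  interpret D: Vector_Spaces.linear s1 s1 D by (rule D)
  note f = Suc.prems
  have z: "lie_der a D (\<lambda>_. 0) xs = 0" for xs by (simp add: lie_der_def a.zero)
  show ?case
  proof (rule cochain_SucI)
    show "lie_der a D f [] = 0" by (simp add: cochain_length[OF f] a.zero)
    have e: "contract x (lie_der a D f) = lie_der a D (contract x f) - contract (D x) f" for x
      by (rule ext) (simp add: contract_def[of x "lie_der a D f"] contract_def[of "D x"] lie_der_Cons)
    show "contract x (lie_der a D f) \<in> cochains s1 s2 n" for x
      unfolding e by (intro cochains_diff Suc.IH cochain_contract f)
    show "Vector_Spaces.linear s1 s2 (\<lambda>x. lie_der a D f (x # vs))" for vs
      unfolding linear_iff lie_der_Cons_explicit
      using f by (simp add: cochain_add_Cons cochain_scale_Cons a.add a.scale D.add D.scale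
          sum.distrib vs2.scale_sum_right vs2.scale_right_diff_distrib algebra_simps)
    \<comment> \<open>The doubly contracted form is zero, and the two terms left over, with
      \<open>x\<close> and \<open>D x\<close> in opposite orders, cancel.\<close>
    have "contract x (contract x f) = (\<lambda>_. 0)" for x
      by (rule ext) (simp add: contract_def cochain_alternating_Cons[OF f])
    then show "lie_der a D f (x # x # vs) = 0" for x vs
      using cochain_swap[OF f, of x "D x" vs] by (simp add: lie_der_Cons contract_def[of x f] z)
  qed
qed

text \<open>Contract by \<open>x\<close> and induct. The commutation rule gives four terms for each
  of the two products; the mixed ones are symmetric under exchanging \<open>(a, D)\<close> with
  \<open>(b, E)\<close> and cancel, and the last ones give the commutator of \<open>D\<close> and
  \<open>E\<close>.\<close>

lemma lie_der_commutator:
  assumes "f \<in> cochains s1 s2 n"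
    and a: "Vector_Spaces.linear s2 s2 a" and b: "Vector_Spaces.linear s2 s2 b"
    and D: "Vector_Spaces.linear s1 s1 D" and E: "Vector_Spaces.linear s1 s1 E"
  shows "lie_der a D (lie_der b E f) - lie_der b E (lie_der a D f) =
    lie_der (\<lambda>m. a (b m) - b (a m)) (\<lambda>x. D (E x) - E (D x)) f"
  using assms(1)
proof (induction n arbitrary: f)
  case 0
  interpret a: Vector_Spaces.linear s2 s2 a by (rule a)
  interpret b: Vector_Spaces.linear s2 s2 b by (rule b)
  have z: "lie_der a D g xs = 0" if "a 0 = 0" "\<And>ys. ys \<noteq> [] \<Longrightarrow> g ys = 0" "xs \<noteq> []" for a D g xs
    using that by (simp add: lie_der_def)
  have "f xs = 0" if "xs \<noteq> []" for xs using cochain_length[OF 0] that by simp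
  then have "(lie_der a D (lie_der b E f) - lie_der b E (lie_der a D f)) xs =
      lie_der (\<lambda>m. a (b m) - b (a m)) (\<lambda>x. D (E x) - E (D x)) f xs" for xs
    by (cases "xs = []") (simp_all add: z a.zero b.zero)
  then show ?case by (intro ext)
next
  case (Suc n)
  interpret a: Vector_Spaces.linear s2 s2 a by (rule a)
  interpret b: Vector_Spaces.linear s2 s2 b by (rule b)
  note f = Suc.prems
  have c: "contract x (lie_der a D f) = lie_der a D (contract x f) - contract (D x) f"
    for x :: 'b and f a D
    by (rule ext) (simp add: contract_def[of x "lie_der a D f"] contract_def[of "D x"] lie_der_Cons)
  have sub: "f ((x - y) # xs) = f (x # xs) - f (y # xs)" for x y xs
    using cochain_add_Cons[OF f, of "x - y" y xs] by simp
  show ?case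
  proof
    fix xs
    show "(lie_der a D (lie_der b E f) - lie_der b E (lie_der a D f)) xs =
      lie_der (\<lambda>m. a (b m) - b (a m)) (\<lambda>x. D (E x) - E (D x)) f xs"
    proof (cases xs)
      case (Cons x ys)
      have e: "lie_der a D (lie_der b E f) (x # ys) =
          lie_der a D (lie_der b E (contract x f)) ys - lie_der a D (contract (E x) f) ys
          - lie_der b E (contract (D x) f) ys + f (E (D x) # ys)"
        if "\<And>u v. a (u - v) = a u - a v" for a b D E
        by (simp add: lie_der_Cons c lie_der_diff that)
      show ?thesis
        using fun_cong[OF Suc.IH[OF cochain_contract[OF f, of x]], of ys]
        by (simp add: Cons e a.diff b.diff lie_der_Cons[of "\<lambda>m. a (b m) - b (a m)"] sub algebra_simps)
    qed simp
  qed
qed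

end

lemma nths_Compl_Cons [simp]:
  "nths (x # xs) (- {0}) = xs"
  "nths (x # xs) (- {Suc i}) = x # nths xs (- {i})"
  "nths (x # xs) (- {0, Suc i}) = nths xs (- {i})"
  "nths (x # xs) (- {Suc i, Suc j}) = x # nths xs (- {i, j})"
  by (simp_all add: nths_Cons nths_all Compl_eq)

lemma nths_Compl_singleton:
  "i < length xs \<Longrightarrow> nths xs (- {i}) = take i xs @ drop (Suc i) xs"
proof (induction xs arbitrary: i)
  case (Cons x xs)
  then show ?case by (cases i) simp_all
qed simp

context lie_module
begin

sublocale pair: vector_space_pair scale scaleM
  by unfold_locales

abbreviation "CE_cochains \<equiv> cochains scale scaleM"
abbreviation "CE_d \<equiv> coboundary bracket scaleM act"
abbreviation "CE_theta x \<equiv> lie_der (act x) (bracket x)"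

lemma linear_ad: "Vector_Spaces.linear scale scale (bracket x)"
  using bracket_linear_right by simp

lemma linear_act: "Vector_Spaces.linear scaleM scaleM (act x)"
  using act_linear_right by simp

lemma act_simps [simp]:
  "act x 0 = 0" "act x (m + m') = act x m + act x m'" "act x (m - m') = act x m - act x m'"
  "act x (- m) = - act x m" "act x (scaleM c m) = scaleM c (act x m)"
  "act 0 m = 0" "act (x + y) m = act x m + act y m" "act (x - y) m = act x m - act y m"
  "act (scale c x) m = scaleM c (act x m)"
proof -
  interpret r: Vector_Spaces.linear scaleM scaleM "\<lambda>m. act x m" for x by (rule act_linear_right)
  interpret l: Vector_Spaces.linear scale scaleM "\<lambda>x. act x m" for m by (rule act_linear_left)
  show "act x 0 = 0" "act x (m + m') = act x m + act x m'" "act x (m - m') = act x m - act x m'"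
    "act x (- m) = - act x m" "act x (scaleM c m) = scaleM c (act x m)"
    "act 0 m = 0" "act (x + y) m = act x m + act y m" "act (x - y) m = act x m - act y m"
    "act (scale c x) m = scaleM c (act x m)"
    by (simp_all add: r.zero r.add r.diff r.neg r.scale l.zero l.add l.diff l.scale)
qed

end

context lie_algebra
begin

lemma bracket_simps [simp]:
  "bracket x 0 = 0" "bracket x (y + z) = bracket x y + bracket x z"
  "bracket x (y - z) = bracket x y - bracket x z"
  "bracket x (- y) = - bracket x y" "bracket x (scale c y) = scale c (bracket x y)"
  "bracket 0 y = 0" "bracket (x + w) y = bracket x y + bracket w y"
  "bracket (x - w) y = bracket x y - bracket w y"
  "bracket (- x) y = - bracket x y" "bracket (scale c x) y = scale c (bracket x y)"
  "bracket x x = 0"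
proof -
  interpret r: Vector_Spaces.linear scale scale "\<lambda>y. bracket x y" for x by (rule bracket_linear_right)
  interpret l: Vector_Spaces.linear scale scale "\<lambda>x. bracket x y" for y by (rule bracket_linear_left)
  show "bracket x 0 = 0" "bracket x (y + z) = bracket x y + bracket x z"
    "bracket x (y - z) = bracket x y - bracket x z"
    "bracket x (- y) = - bracket x y" "bracket x (scale c y) = scale c (bracket x y)"
    "bracket 0 y = 0" "bracket (x + w) y = bracket x y + bracket w y"
    "bracket (x - w) y = bracket x y - bracket w y"
    "bracket (- x) y = - bracket x y" "bracket (scale c x) y = scale c (bracket x y)"
    "bracket x x = 0"
    by (simp_all add: r.zero r.add r.diff r.neg r.scale l.zero l.add l.diff l.neg l.scale bracket_self)
qed

lemma bracket_antisym: "bracket x y = - bracket y x"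
proof -
  have "0 = bracket (x + y) (x + y)" by (simp only: bracket_self)
  also have "\<dots> = bracket x (x + y) + bracket y (x + y)" by (rule bracket_simps(7))
  finally show ?thesis by (simp add: eq_neg_iff_add_eq_0)
qed

lemma bracket_derivation:
  "bracket x (bracket y z) = bracket (bracket x y) z + bracket y (bracket x z)"
  using jacobi[of x y z] bracket_antisym[of y "bracket z x"] bracket_antisym[of z x]
    bracket_antisym[of z "bracket x y"] by (simp add: algebra_simps)

end

section \<open>Cartan's formula and the Chevalley-Eilenberg differential\<close>

context lie_module
begin

lemma coboundary_0_Cons:
  assumes "f \<in> CE_cochains 0"
  shows "CE_d 0 f (x # xs) = CE_theta x f xs"
proof (cases xs)
  case Nil
  then show ?thesis by (simp add: coboundary_def)
next
  case (Cons y ys)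
  have "CE_theta x f \<in> CE_cochains 0"
    by (rule pair.cochain_lie_der[OF assms linear_act linear_ad])
  then show ?thesis by (simp add: coboundary_def Cons pair.cochain_length)
qed

text \<open>Cartan's formula \<open>\<theta>\<^sub>x = i\<^sub>x d + d i\<^sub>x\<close>, read as a recursion for \<open>d\<close>.\<close>

lemma coboundary_Suc_Cons:
  assumes f: "f \<in> CE_cochains (Suc n)"
  shows "CE_d (Suc n) f (x # xs) = CE_theta x f xs - CE_d n (contract x f) xs"
proof (cases "length xs = Suc n")
  case False
  have "CE_theta x f \<in> CE_cochains (Suc n)"
    by (rule pair.cochain_lie_der[OF f linear_act linear_ad])
  then show ?thesis using False by (simp add: coboundary_def pair.cochain_length)
next
  case True
  have upd: "f (xs[j := y]) = scaleM ((- 1) ^ j) (f (y # nths xs (- {j})))" if "j \<le> n" for j y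
    using that True pair.cochain_move_front[OF f, of "take j xs" y "drop (Suc j) xs"]
    by (simp add: upd_conv_take_nth_drop nths_Compl_singleton)
  \<comment> \<open>By \<open>upd\<close>, the pairs containing position 0 are the Lie derivative
    terms. In the others \<open>x\<close> stands second, and swapping it to the front gives the
    double sum for \<open>contract x f\<close> with a minus sign.\<close>
  have inner: "(\<Sum>i<Suc j. scaleM ((- 1) ^ (i + Suc j))
        (f (bracket ((x # xs) ! i) ((x # xs) ! Suc j) # nths (x # xs) (- {i, Suc j})))) =
      - f (xs[j := bracket x (xs ! j)]) -
      (\<Sum>i<j. scaleM ((- 1) ^ (i + j))
        (contract x f (bracket (xs ! i) (xs ! j) # nths xs (- {i, j}))))" if "j \<le> n" for j
    unfolding sum.lessThan_Suc_shift upd[OF that] contract_def sum_negf[symmetric] diff_conv_add_uminus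
    by (intro arg_cong2[of _ _ _ _ "(+)"] sum.cong)
      (auto simp: pair.cochain_swap[OF f, of x])
  have "(\<Sum>j\<le>Suc n. \<Sum>i<j. scaleM ((- 1) ^ (i + j))
        (f (bracket ((x # xs) ! i) ((x # xs) ! j) # nths (x # xs) (- {i, j})))) =
      (\<Sum>j\<le>n. \<Sum>i<Suc j. scaleM ((- 1) ^ (i + Suc j))
        (f (bracket ((x # xs) ! i) ((x # xs) ! Suc j) # nths (x # xs) (- {i, Suc j}))))"
    by (subst sum.atMost_Suc_shift) simp
  also have "\<dots> = (\<Sum>j\<le>n. - f (xs[j := bracket x (xs ! j)]) -
      (\<Sum>i<j. scaleM ((- 1) ^ (i + j))
        (contract x f (bracket (xs ! i) (xs ! j) # nths xs (- {i, j})))))"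
    by (intro sum.cong refl inner) simp
  finally have quad: "(\<Sum>j\<le>Suc n. \<Sum>i<j. scaleM ((- 1) ^ (i + j))
        (f (bracket ((x # xs) ! i) ((x # xs) ! j) # nths (x # xs) (- {i, j})))) = \<dots>" .
  have lin: "(\<Sum>i\<le>Suc n. scaleM ((- 1) ^ i) (act ((x # xs) ! i) (f (nths (x # xs) (- {i}))))) =
      act x (f xs) - (\<Sum>i\<le>n. scaleM ((- 1) ^ i) (act (xs ! i) (contract x f (nths xs (- {i})))))"
    by (subst sum.atMost_Suc_shift) (simp add: sum_negf contract_def)
  have len: "length (x # xs) = Suc (Suc n)" using True by simp
  show ?thesis
    unfolding coboundary_def if_P[OF len] if_P[OF True] quad lin lie_der_def True lessThan_Suc_atMost
    by (simp add: sum_negf sum_subtractf)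
qed

lemma coboundary_Nil [simp]: "CE_d n f [] = 0"
  by (simp add: coboundary_def)

lemma coboundary_add: "CE_d n (f + g) = CE_d n f + CE_d n g"
  by (rule ext) (simp add: coboundary_def M.scale_right_distrib sum.distrib)

lemma coboundary_scale: "CE_d n (\<lambda>xs. scaleM c (f xs)) = (\<lambda>xs. scaleM c (CE_d n f xs))"
  by (rule ext) (simp add: coboundary_def M.scale_right_distrib M.scale_sum_right
      mult.commute)

lemma coboundary_diff: "CE_d n (f - g) = CE_d n f - CE_d n g"
  using coboundary_add[of n "f - g" g] by (simp add: algebra_simps)

lemma coboundary_zero: "CE_d n 0 = 0"
  using coboundary_diff[of n 0 0] by simp

lemma contract_coboundary_0:
  "f \<in> CE_cochains 0 \<Longrightarrow> contract x (CE_d 0 f) = CE_theta x f"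
  by (rule ext) (simp add: contract_def coboundary_0_Cons)

lemma contract_coboundary_Suc:
  "f \<in> CE_cochains (Suc n) \<Longrightarrow>
    contract x (CE_d (Suc n) f) = CE_theta x f - CE_d n (contract x f)"
  by (rule ext) (simp add: contract_def[of x "CE_d (Suc n) f"] coboundary_Suc_Cons)

lemma theta_cochain: "f \<in> CE_cochains n \<Longrightarrow> CE_theta x f \<in> CE_cochains n"
  by (rule pair.cochain_lie_der[OF _ linear_act linear_ad])

lemma linear_theta:
  assumes f: "f \<in> CE_cochains n"
  shows "Vector_Spaces.linear scale scaleM (\<lambda>x. CE_theta x f xs)"
  unfolding pair.linear_iff lie_der_def
  using f by (auto simp: M.scale_sum_right M.scale_right_diff_distrib sum.distrib
      upd_conv_take_nth_drop pair.cochain_add pair.cochain_scale)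

lemma coboundary_cochain:
  assumes "f \<in> CE_cochains n"
  shows "CE_d n f \<in> CE_cochains (Suc n)"
  using assms
proof (induction n arbitrary: f)
  case 0
  show ?case
  proof (rule pair.cochain_SucI)
    show "contract x (CE_d 0 f) \<in> CE_cochains 0" for x
      using theta_cochain[OF 0] by (simp add: contract_coboundary_0[OF 0])
    show "Vector_Spaces.linear scale scaleM (\<lambda>x. CE_d 0 f (x # vs))" for vs
      using linear_theta[OF 0] by (simp add: coboundary_0_Cons[OF 0])
    show "CE_d 0 f (x # x # vs) = 0" for x vs
      by (simp add: coboundary_def)
  qed simp
next
  case (Suc n)
  note f = Suc.prems
  show ?case
  proof (rule pair.cochain_SucI)
    show "contract x (CE_d (Suc n) f) \<in> CE_cochains (Suc n)" for x
      unfolding contract_coboundary_Suc[OF f]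
      by (intro pair.cochains_diff theta_cochain f Suc.IH pair.cochain_contract)
    show "Vector_Spaces.linear scale scaleM (\<lambda>x. CE_d (Suc n) f (x # vs))" for vs
    proof -
      have "contract (x + y) f = contract x f + contract y f" for x y
        by (rule ext) (simp add: contract_def pair.cochain_add_Cons[OF f])
      moreover have "contract (scale c x) f = (\<lambda>xs. scaleM c (contract x f xs))" for c x
        by (rule ext) (simp add: contract_def pair.cochain_scale_Cons[OF f])
      ultimately show ?thesis
        using linear_theta[OF f, of vs]
        by (simp add: pair.linear_iff coboundary_Suc_Cons[OF f] coboundary_add coboundary_scale
            M.scale_right_diff_distrib)
    qed
    show "CE_d (Suc n) f (x # x # vs) = 0" for x vs
    proof -
      \<comment> \<open>Cartan's formula is applied again, to \<open>contract x f\<close>. The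
        double contraction kills its last term, and what is left equals the Lie derivative term of
        the first application because \<open>bracket x x\<close> is zero.\<close>
      have "contract x (contract x f) = 0"
        by (rule ext) (simp add: contract_def pair.cochain_alternating_Cons[OF f])
      moreover have "CE_d n (contract x f) (x # vs) =
          CE_theta x (contract x f) vs - (if n = 0 then 0 else CE_d (n - 1) (contract x (contract x f)) vs)"
        using pair.cochain_contract[OF f, of x]
        by (cases n) (simp_all add: coboundary_0_Cons coboundary_Suc_Cons)
      ultimately have "CE_d n (contract x f) (x # vs) = CE_theta x (contract x f) vs"
        by (simp add: coboundary_zero)
      then show ?thesis
        using pair.cochain_add_Cons[OF f, of 0 0 vs]
        by (simp add: coboundary_Suc_Cons[OF f] lie_der_Cons)
    qed
  qed simp
qed

text \<open>By \<open>compat\<close> and \<open>deriv\<close> the commutator with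
  \<open>CE_theta y\<close> is \<open>CE_theta (D y)\<close>. Comparing contractions by
  \<open>y\<close> through Cartan's formula then reduces the claim to lower degree.\<close>

lemma lie_der_coboundary:
  assumes "f \<in> CE_cochains n"
    and a: "Vector_Spaces.linear scaleM scaleM a" and D: "Vector_Spaces.linear scale scale D"
    and compat: "\<And>y m. a (act y m) - act y (a m) = act (D y) m"
    and deriv: "\<And>x y. D (bracket x y) = bracket (D x) y + bracket x (D y)"
  shows "lie_der a D (CE_d n f) = CE_d n (lie_der a D f)"
  using assms(1)
proof (induction n arbitrary: f)
  interpret a: Vector_Spaces.linear scaleM scaleM a by (rule a)
  have bracket: "lie_der a D (CE_theta y f) xs - CE_theta y (lie_der a D f) xs = CE_theta (D y) f xs"
    if "f \<in> CE_cochains n" for f y n xs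
    using fun_cong[OF pair.lie_der_commutator[OF that a linear_act D linear_ad, of y y], of xs]
    by (simp add: compat deriv)
  {
    case 0
    note d0 = pair.cochain_lie_der[OF 0 a D]
    show ?case
    proof
      fix xs show "lie_der a D (CE_d 0 f) xs = CE_d 0 (lie_der a D f) xs"
      proof (cases xs)
        case (Cons y ys)
        then show ?thesis
          using bracket[OF 0, of y ys]
          by (simp add: lie_der_Cons coboundary_0_Cons 0 d0 contract_coboundary_0 algebra_simps)
      qed (simp add: a.zero)
    qed
  next
    case (Suc n)
    note f = Suc.prems
    note df = pair.cochain_lie_der[OF f a D]
    have c: "contract x (lie_der a D f) = lie_der a D (contract x f) - contract (D x) f" for x
      by (rule ext) (simp add: contract_def[of x "lie_der a D f"] contract_def[of "D x"] lie_der_Cons)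
    show ?case
    proof
      fix xs show "lie_der a D (CE_d (Suc n) f) xs = CE_d (Suc n) (lie_der a D f) xs"
      proof (cases xs)
        case (Cons y ys)
        then show ?thesis
          using bracket[OF f, of y ys] Suc.IH[OF pair.cochain_contract[OF f, of y]]
          by (simp add: lie_der_Cons[of a D "CE_d (Suc n) f"] coboundary_Suc_Cons f df
              contract_coboundary_Suc c lie_der_diff coboundary_diff a.diff algebra_simps)
      qed (simp add: a.zero)
    qed
  }
qed

lemma theta_coboundary:
  "f \<in> CE_cochains n \<Longrightarrow> CE_theta x (CE_d n f) = CE_d n (CE_theta x f)"
  by (rule lie_der_coboundary)
    (simp_all add: linear_act linear_ad act_bracket bracket_derivation[of x])

text \<open>The coboundary commutes with \<open>CE_theta x\<close>, so two uses of Cartan's formula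
  identify the contraction of the double coboundary with the double coboundary of
  \<open>contract x f\<close>.\<close>

lemma coboundary_coboundary:
  assumes "f \<in> CE_cochains n"
  shows "CE_d (Suc n) (CE_d n f) = 0"
  using assms
proof (induction n arbitrary: f)
  case 0
  note d = coboundary_cochain[OF 0]
  show ?case
  proof
    fix xs show "CE_d (Suc 0) (CE_d 0 f) xs = 0 xs"
      by (cases xs) (simp_all add: coboundary_Suc_Cons d contract_coboundary_0 0 theta_coboundary)
  qed
next
  case (Suc n)
  note d = coboundary_cochain[OF Suc.prems]
  show ?case
  proof
    fix xs show "CE_d (Suc (Suc n)) (CE_d (Suc n) f) xs = 0 xs"
      by (cases xs) (simp_all add: coboundary_Suc_Cons d contract_coboundary_Suc Suc.prems
          theta_coboundary coboundary_diff Suc.IH pair.cochain_contract)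
  qed
qed

end

section \<open>Cohomology of a subalgebra and extensions of codimension one\<close>

text \<open>Forms on a subalgebra \<open>S\<close> are represented by forms on the whole algebra
  modulo this relation, which avoids a separate type for \<open>S\<close>.\<close>

definition agree :: "'a set \<Rightarrow> ('a list \<Rightarrow> 'm) \<Rightarrow> ('a list \<Rightarrow> 'm) \<Rightarrow> bool" where
  "agree S f g \<longleftrightarrow> (\<forall>xs. set xs \<subseteq> S \<longrightarrow> f xs = g xs)"

lemma agree_refl [simp]: "agree S f f"
  by (simp add: agree_def)

lemma agree_sym: "agree S f g \<Longrightarrow> agree S g f"
  by (simp add: agree_def)

lemma agree_trans [trans]: "agree S f g \<Longrightarrow> agree S g h \<Longrightarrow> agree S f h"
  by (simp add: agree_def)

lemma agree_mono: "agree T f g \<Longrightarrow> S \<subseteq> T \<Longrightarrow> agree S f g"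
  by (auto simp: agree_def)

lemma agree_diff: "agree S f g \<Longrightarrow> agree S f' g' \<Longrightarrow> agree S (f - f') (g - g')"
  by (simp add: agree_def)

lemma agree_add: "agree S f g \<Longrightarrow> agree S f' g' \<Longrightarrow> agree S (f + f') (g + g')"
  by (simp add: agree_def)

lemma agree_diff_iff: "agree S f g \<longleftrightarrow> agree S (f - g) 0" for f g :: "'a list \<Rightarrow> 'm::ab_group_add"
  by (simp add: agree_def)

lemma agree_contract: "agree S f g \<Longrightarrow> x \<in> S \<Longrightarrow> agree S (contract x f) (contract x g)"
  by (simp add: agree_def contract_def)

lemma agree_lie_der:
  assumes "agree S f g" "D ` S \<subseteq> S"
  shows "agree S (lie_der a D f) (lie_der a D g)"
  unfolding agree_def lie_der_def
proof (intro allI impI)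
  fix xs assume xs: "set xs \<subseteq> S"
  have "set (xs[i := D (xs ! i)]) \<subseteq> S" if "i < length xs" for i
    using set_update_subset_insert[of xs i "D (xs ! i)"] xs that assms(2) nth_mem[OF that] by blast
  then show "a (f xs) - (\<Sum>i<length xs. f (xs[i := D (xs ! i)])) =
      a (g xs) - (\<Sum>i<length xs. g (xs[i := D (xs ! i)]))"
    using assms(1) xs by (simp add: agree_def)
qed

text \<open>Write every argument as an element of \<open>S\<close> plus a multiple of
  \<open>z\<close>. By alternation only terms with at most one \<open>z\<close> survive, and the two
  vanishing hypotheses cover these.\<close>

lemma (in vector_space_pair) agree_spanI:
  assumes "f \<in> cochains s1 s2 j" "agree S f 0" "agree S (contract z f) 0"
    and T: "\<And>x. x \<in> T \<Longrightarrow> \<exists>s c. s \<in> S \<and> x = s + s1 c z"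
  shows "agree T f 0"
proof -
  have "f xs = 0" if "set xs \<subseteq> T" for xs
    using that assms(1-3)
  proof (induction xs arbitrary: f j)
    case Nil
    then show ?case by (simp add: agree_def)
  next
    case (Cons x xs)
    note f = Cons.prems(2)
    obtain s c where s: "s \<in> S" "x = s + s1 c z" using T[of x] Cons.prems(1) by auto
    have "contract s f xs = 0"
    proof (rule Cons.IH)
      show "contract s f \<in> cochains s1 s2 (j - 1)" by (rule cochain_contract_pred[OF f])
      show "agree S (contract s f) 0"
        using Cons.prems(3) s by (simp add: agree_def contract_def)
      show "agree S (contract z (contract s f)) 0"
        using Cons.prems(4) s cochain_swap[OF f, of s z] by (simp add: agree_def contract_def)
    qed (use Cons.prems in simp)
    moreover have "contract z f xs = 0"
    proof (rule Cons.IH)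
      show "contract z f \<in> cochains s1 s2 (j - 1)" by (rule cochain_contract_pred[OF f])
      show "agree S (contract z (contract z f)) 0"
        by (simp add: agree_def contract_def cochain_alternating_Cons[OF f])
    qed (use Cons.prems in simp_all)
    ultimately show ?case
      by (simp add: s cochain_add_Cons[OF f] cochain_scale_Cons[OF f] contract_def)
  qed
  then show ?thesis by (simp add: agree_def)
qed

text \<open>
  The exterior product of a functional \<open>\<lambda>\<close> with a cochain is the coboundary for the zero bracket
  and the action \<open>x \<mapsto> \<lambda>(x)\<close>.
\<close>

definition wedge ::
    "('k::field \<Rightarrow> 'm::ab_group_add \<Rightarrow> 'm) \<Rightarrow> ('a \<Rightarrow> 'k) \<Rightarrow> nat \<Rightarrow>
     ('a::ab_group_add list \<Rightarrow> 'm) \<Rightarrow> 'a list \<Rightarrow> 'm" where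
  "wedge scaleM l n = coboundary (\<lambda>_ _. 0) scaleM (\<lambda>x. scaleM (l x)) n"

context vector_space_pair
begin

text \<open>A functional is a representation of the abelian Lie algebra since scalars commute; this
  makes the Cartan calculus available for exterior products.\<close>

lemma lie_module_functional:
  assumes l: "Vector_Spaces.linear s1 (*) l"
  shows "lie_module s1 (\<lambda>_ _. 0) s2 (\<lambda>x. s2 (l x))"
proof -
  interpret l: Vector_Spaces.linear s1 "(*)" l by (rule l)
  show ?thesis
    by unfold_locales
      (auto simp: l.add l.scale vs2.scale_right_distrib vs2.scale_left_distrib mult.commute)
qed

text \<open>For the zero bracket the Lie derivative along \<open>z\<close> is multiplication by
  \<open>l z\<close>, which is 1. Cartan's formula thus gives \<open>g\<close> minus a wedge of
  \<open>l\<close> with \<open>contract z g\<close>, and wedges with \<open>l\<close> vanish on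
  \<open>S\<close>.\<close>

lemma wedge:
  assumes l: "Vector_Spaces.linear s1 (*) l" and g: "g \<in> cochains s1 s2 n"
    and S: "\<And>x. x \<in> S \<Longrightarrow> l x = 0" and z: "l z = 1"
  shows wedge_cochain: "wedge s2 l n g \<in> cochains s1 s2 (Suc n)"
    and agree_wedge: "agree S (wedge s2 l n g) 0"
    and agree_contract_wedge: "agree S (contract z (wedge s2 l n g)) g"
proof -
  note W = lie_module_functional[OF l]
  show "wedge s2 l n g \<in> cochains s1 s2 (Suc n)"
    unfolding wedge_def by (rule lie_module.coboundary_cochain[OF W g])
  have zero: "h (0 # xs) = 0" if "h \<in> cochains s1 s2 m" for h m xs
    using cochain_scale_Cons[OF that, of 0 0 xs] by simp
  have ag: "agree S (wedge s2 l n g) 0" if "g \<in> cochains s1 s2 n" for n g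
    using S by (auto simp: agree_def wedge_def coboundary_def zero[OF that] subset_iff)
  show "agree S (wedge s2 l n g) 0" by (rule ag[OF g])
  have upd: "g (xs[i := 0]) = 0" if "i < length xs" for xs i
    using cochain_scale[OF g, of "take i xs" 0 0] that by (simp add: upd_conv_take_nth_drop)
  have th: "lie_der (s2 (l z)) (\<lambda>_. 0) g = g"
    by (rule ext) (simp add: lie_der_def z upd)
  show "agree S (contract z (wedge s2 l n g)) g"
  proof (cases n)
    case 0
    then show ?thesis using lie_module.contract_coboundary_0[OF W, of g z] g by (simp add: wedge_def th)
  next
    case (Suc m)
    then have "contract z (wedge s2 l n g) = g - wedge s2 l m (contract z g)"
      using lie_module.contract_coboundary_Suc[OF W, of g m z] g by (simp add: wedge_def th)
    moreover have "agree S (wedge s2 l m (contract z g)) 0"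
      using ag[OF cochain_contract, of g m z] g Suc by simp
    ultimately show ?thesis using agree_diff[of S g g _ 0] by simp
  qed
qed

end

section \<open>Relative vanishing along an extension of codimension one\<close>

context lie_module
begin

definition rel_exact :: "'a set \<Rightarrow> nat \<Rightarrow> ('a list \<Rightarrow> 'm) \<Rightarrow> bool" where
  "rel_exact S j f \<longleftrightarrow>
     (case j of 0 \<Rightarrow> agree S f 0 | Suc k \<Rightarrow> \<exists>g\<in>CE_cochains k. agree S f (CE_d k g))"

text \<open>
  The vanishing of the cohomology of a subalgebra \<open>S\<close>, expressed with cochains of the whole algebra:
  every alternating form on \<open>S\<close> extends to the whole algebra.
\<close>

definition rel_vanishes :: "'a set \<Rightarrow> nat \<Rightarrow> bool" where
  "rel_vanishes S j \<longleftrightarrow>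
     (\<forall>f\<in>CE_cochains j. agree S (CE_d j f) 0 \<longrightarrow> rel_exact S j f)"

definition bracket_closed :: "'a set \<Rightarrow> bool" where
  "bracket_closed S \<longleftrightarrow> (\<forall>x\<in>S. \<forall>y\<in>S. bracket x y \<in> S)"

lemma agree_coboundary:
  assumes S: "bracket_closed S" and "agree S f g"
  shows "agree S (CE_d n f) (CE_d n g)"
  unfolding agree_def
proof (intro allI impI)
  fix xs assume xs: "set xs \<subseteq> S"
  have sub: "set (nths xs A) \<subseteq> S" for A
    using set_nths_subset[of xs A] xs by blast
  have "bracket (xs ! i) (xs ! j) \<in> S" if "i < length xs" "j < length xs" for i j
    using S xs that nth_mem[of _ xs] unfolding bracket_closed_def by blast
  then show "CE_d n f xs = CE_d n g xs"
    using assms(2) sub by (simp add: coboundary_def agree_def)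
qed

lemma agree_coboundary_0:
  "bracket_closed S \<Longrightarrow> agree S f 0 \<Longrightarrow> agree S (CE_d n f) 0"
  using agree_coboundary[of S f 0 n] by (simp add: coboundary_zero)

text \<open>For a cocycle on \<open>S\<close>, Cartan's formula leaves only the coboundary of
  \<open>contract x f\<close>; agreement on \<open>S\<close> survives contraction because
  \<open>x\<close> lies in \<open>S\<close>.\<close>

lemma theta_rel_cocycle:
  assumes "f \<in> CE_cochains j" "agree S (CE_d j f) 0" "x \<in> S"
  shows "rel_exact S j (CE_theta x f)"
proof (cases j)
  case 0
  then show ?thesis
    using agree_contract[OF assms(2,3)] assms(1)
    by (simp add: rel_exact_def contract_coboundary_0) (simp add: agree_def contract_def)
next
  case (Suc k)
  have "agree S (CE_theta x f) (CE_d k (contract x f))"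
    using agree_contract[OF assms(2,3)] assms(1)
    unfolding Suc agree_diff_iff[of S "CE_theta x f"]
    by (simp add: contract_coboundary_Suc) (simp add: agree_def contract_def)
  then show ?thesis
    using pair.cochain_contract assms(1) by (auto simp: rel_exact_def Suc)
qed

text \<open>By \<open>triv\<close> the long exact sequence splits into short ones with H^j(T)
  between H^(j-1)(S) and H^j(S). \<open>down\<close> rests on the surjectivity of restriction to
  \<open>S\<close>, \<open>up\<close> on exactness in the middle.\<close>

lemma rel_vanishes_codim_one:
  assumes S: "bracket_closed S" and zS: "bracket z ` S \<subseteq> S"
    and T: "T = {s + scale c z | s c. s \<in> S}" and S0: "0 \<in> S" and T_closed: "bracket_closed T"
    and l: "Vector_Spaces.linear scale (*) l" "\<And>x. x \<in> S \<Longrightarrow> l x = 0" "l z = 1"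
    and triv: "\<And>j f. f \<in> CE_cochains j \<Longrightarrow> agree S (CE_d j f) 0 \<Longrightarrow> rel_exact S j (CE_theta z f)"
  shows "(\<forall>j\<le>n. rel_vanishes S j) \<longleftrightarrow> (\<forall>j\<le>n. rel_vanishes T j)"
proof -
  have ST: "S \<subseteq> T" 
  proof
    fix s assume "s \<in> S"
    moreover have "s = s + scale 0 z" by simp
    ultimately show "s \<in> T" unfolding T by blast
  qed
  have zT: "z \<in> T" 
  proof -
    have "z = 0 + scale 1 z" by simp
    then show ?thesis unfolding T using S0 by blast
  qed
  have agT: "agree T f 0" if "f \<in> CE_cochains j" "agree S f 0" "agree S (contract z f) 0" for f j
    by (rule pair.agree_spanI[OF that]) (auto simp: T)
  note w = pair.wedge_cochain[OF l(1)] and wS = pair.agree_wedge[OF l(1)]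
    and wz = pair.agree_contract_wedge[OF l(1)]
  have down: "rel_vanishes S j" if V: "rel_vanishes T j" for j
    unfolding rel_vanishes_def
  proof (intro ballI impI)
    fix f assume f: "f \<in> CE_cochains j" and df: "agree S (CE_d j f) 0"
    show "rel_exact S j f"
    proof (cases j)
      case 0
      have "agree S (contract z (CE_d 0 f)) 0"
        using triv[OF f df] f by (simp add: 0 rel_exact_def contract_coboundary_0)
      then have "agree T (CE_d j f) 0"
        using agT[OF coboundary_cochain[OF f] df] by (simp add: 0)
      then have "agree T f 0"
        using V f by (simp add: rel_vanishes_def rel_exact_def 0)
      then show ?thesis using agree_mono[OF _ ST] by (simp add: 0 rel_exact_def)
    next
      case (Suc k)
      obtain g where g: "g \<in> CE_cochains k" and tf: "agree S (CE_theta z f) (CE_d k g)"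
        using triv[OF f df] by (auto simp: Suc rel_exact_def)
      \<comment> \<open>\<open>h\<close> is chosen so that \<open>f'\<close>, which restricts to
        \<open>S\<close> like \<open>f\<close>, has contraction \<open>g\<close> there. In Cartan's
        formula \<open>CE_theta z f'\<close> then cancels against the coboundary of
        \<open>g\<close>, so \<open>f'\<close> is a cocycle on \<open>T\<close>.\<close>
      define h where "h = g - contract z f"
      have h: "h \<in> CE_cochains k"
        using g f by (simp add: h_def Suc pair.cochains_diff pair.cochain_contract)
      define f' where "f' = f + wedge scaleM l k h"
      have f': "f' \<in> CE_cochains (Suc k)"
        using f w[OF h l(2,3)] by (simp add: f'_def Suc pair.cochains_add)
      have ff': "agree S f' f"
        using agree_add[OF agree_refl[of S f] wS[OF h l(2,3)]] by (simp add: f'_def)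
      have "contract z f' = contract z f + contract z (wedge scaleM l k h)"
        by (simp add: f'_def contract_add)
      then have zf': "agree S (contract z f') g"
        using agree_add[OF agree_refl[of S "contract z f"] wz[OF h l(2,3)]] by (simp add: h_def)
      have "agree S (CE_d (Suc k) f') 0"
        using agree_trans[OF agree_coboundary[OF S ff'] df[unfolded Suc]] .
      moreover have "agree S (contract z (CE_d (Suc k) f')) 0"
        unfolding contract_coboundary_Suc[OF f']
        using agree_diff[OF agree_trans[OF agree_lie_der[OF ff' zS, of "act z"] tf]
            agree_coboundary[OF S zf', of k]] by simp
      ultimately have "agree T (CE_d (Suc k) f') 0"
        by (rule agT[OF coboundary_cochain[OF f']])
      then obtain u where u: "u \<in> CE_cochains k" "agree T f' (CE_d k u)"
        using V f' by (auto simp: rel_vanishes_def rel_exact_def Suc)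
      then have "agree S f (CE_d k u)"
        using agree_trans[OF agree_sym[OF ff'] agree_mono[OF _ ST]] by blast
      then show ?thesis using u(1) by (auto simp: rel_exact_def Suc)
    qed
  qed
  have up: "rel_vanishes T j" if V: "rel_vanishes S j" and V': "rel_vanishes S (j - 1)" for j
    unfolding rel_vanishes_def
  proof (intro ballI impI)
    fix f assume f: "f \<in> CE_cochains j" and df: "agree T (CE_d j f) 0"
    show "rel_exact T j f"
    proof (cases j)
      case 0
      have "agree S f 0"
        using V f agree_mono[OF df ST] by (simp add: rel_vanishes_def rel_exact_def 0)
      moreover have "agree S (contract z f) 0"
        using f by (simp add: 0 agree_def contract_def pair.cochain_length)
      ultimately show ?thesis using agT[OF f] by (simp add: rel_exact_def 0)
    next
      case (Suc k)
      obtain g where g: "g \<in> CE_cochains k" and fg: "agree S f (CE_d k g)"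
        using V f agree_mono[OF df ST] by (auto simp: rel_vanishes_def rel_exact_def Suc)
      \<comment> \<open>Removing the primitive found on \<open>S\<close> makes the form vanish on
        \<open>S\<close>. Its contraction by \<open>z\<close> is then a cocycle on \<open>S\<close>,
        to which vanishing in degree \<open>j - 1\<close> applies.\<close>
      define f1 where "f1 = f - CE_d k g"
      have f1: "f1 \<in> CE_cochains (Suc k)"
        using f coboundary_cochain[OF g] by (simp add: f1_def Suc pair.cochains_diff)
      have f1S: "agree S f1 0" using fg by (simp add: f1_def flip: agree_diff_iff)
      have "CE_d (Suc k) f1 = CE_d (Suc k) f"
        by (simp add: f1_def coboundary_diff coboundary_coboundary[OF g])
      then have "agree S (contract z (CE_d (Suc k) f1)) 0"
        using agree_mono[OF agree_contract[OF df zT] ST] by (simp add: Suc) (simp add: agree_def contract_def)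
      then have "agree S (CE_theta z f1 - CE_d k (contract z f1)) 0"
        by (simp add: contract_coboundary_Suc[OF f1])
      moreover have "agree S (CE_theta z f1) (CE_theta z 0)"
        by (rule agree_lie_der[OF f1S zS])
      then have "agree S (CE_theta z f1) 0" by (simp add: agree_def lie_der_def)
      ultimately have "agree S (CE_d k (contract z f1)) 0"
        by (simp add: agree_def)
      then have ex: "rel_exact S k (contract z f1)"
        using V' pair.cochain_contract[OF f1] by (simp add: rel_vanishes_def Suc)
      show ?thesis
      proof (cases k)
        case 0
        then have "agree T f1 0" using agT[OF f1 f1S] ex by (simp add: rel_exact_def)
        then show ?thesis using g by (auto simp: rel_exact_def Suc f1_def simp flip: agree_diff_iff)
      next
        case (Suc i)
        obtain h where h: "h \<in> CE_cochains i" and zh: "agree S (contract z f1) (CE_d i h)"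
          using ex by (auto simp: rel_exact_def Suc)
        \<comment> \<open>\<open>h'\<close> vanishes on \<open>S\<close> and contracts to
          \<open>h\<close>, so its coboundary vanishes on \<open>S\<close> and contracts to minus
          that of \<open>h\<close>. Adding this coboundary to \<open>f1\<close> cancels the
          contraction of \<open>f1\<close> on \<open>S\<close>.\<close>
        define h' where "h' = wedge scaleM l i h"
        have h': "h' \<in> CE_cochains (Suc i)" unfolding h'_def by (rule w[OF h l(2,3)])
        have h'S: "agree S h' 0" unfolding h'_def by (rule wS[OF h l(2,3)])
        have h'z: "agree S (contract z h') h" unfolding h'_def by (rule wz[OF h l(2,3)])
        have "agree S (CE_theta z h') (CE_theta z 0)"
          by (rule agree_lie_der[OF h'S zS])
        then have th: "agree S (CE_theta z h') 0" by (simp add: agree_def lie_der_def)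
        have "agree S (contract z (CE_d (Suc i) h')) (0 - CE_d i h)"
          unfolding contract_coboundary_Suc[OF h']
          by (rule agree_diff[OF th agree_coboundary[OF S h'z]])
        then have "agree S (contract z (f1 + CE_d (Suc i) h')) (CE_d i h + (0 - CE_d i h))"
          unfolding contract_add by (rule agree_add[OF zh])
        moreover have "agree S (f1 + CE_d (Suc i) h') (0 + 0)"
          by (rule agree_add[OF f1S agree_coboundary_0[OF S h'S]])
        moreover have "f1 + CE_d (Suc i) h' \<in> CE_cochains (Suc k)"
          using f1 coboundary_cochain[OF h'] by (simp add: Suc pair.cochains_add)
        ultimately have "agree T (f1 + CE_d (Suc i) h') 0" using agT by simp
        then have "agree T f (CE_d k (g - h'))"
          by (simp add: Suc f1_def coboundary_diff agree_def algebra_simps)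
        then show ?thesis
          using pair.cochains_diff[OF g] h' by (auto simp: rel_exact_def \<open>j = Suc k\<close> Suc)
      qed
    qed
  qed
  show ?thesis
    using down up by (meson diff_le_self le_trans)
qed

end

section \<open>Powers of derivations in prime characteristic\<close>

context vector_space
begin

lemma commuting_diff_power:
  assumes P: "Vector_Spaces.linear scale scale P" and Q: "Vector_Spaces.linear scale scale Q"
    and comm: "\<And>v. P (Q v) = Q (P v)"
  shows "((\<lambda>v. P v - Q v) ^^ m) v =
    (\<Sum>k\<le>m. scale (of_nat (m choose k) * (- 1) ^ k) ((P ^^ (m - k)) ((Q ^^ k) v)))"
proof (induction m)
  case (Suc m)
  interpret P: Vector_Spaces.linear scale scale P by (rule P)
  interpret Q: Vector_Spaces.linear scale scale Q by (rule Q)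
  have Q_pow: "Q ((P ^^ j) u) = (P ^^ j) (Q u)" for j u
    by (induction j) (simp_all flip: comm)
  let ?A = "\<lambda>k j. (P ^^ k) ((Q ^^ j) v)"
  let ?c = "\<lambda>m k. of_nat (m choose k) * (- 1) ^ k :: 'a"
  have P_sum: "P (\<Sum>k\<le>m. scale (?c m k) (?A (m - k) k)) =
      (\<Sum>k\<le>Suc m. scale (?c m k) (?A (Suc m - k) k))"
    by (simp add: P.sum P.scale Suc_diff_le binomial_eq_0)
  have Q_sum: "Q (\<Sum>k\<le>m. scale (?c m k) (?A (m - k) k)) =
      (\<Sum>k\<le>m. scale (?c m k) (?A (m - k) (Suc k)))"
    by (simp add: Q.sum Q.scale Q_pow)
  have "((\<lambda>v. P v - Q v) ^^ Suc m) v =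
      (\<Sum>k\<le>Suc m. scale (?c m k) (?A (Suc m - k) k)) -
      (\<Sum>k\<le>m. scale (?c m k) (?A (m - k) (Suc k)))"
    by (simp add: Suc.IH P_sum Q_sum del: sum.atMost_Suc)
  also have "\<dots> = ?A (Suc m) 0 +
      (\<Sum>k\<le>m. scale (?c m (Suc k)) (?A (m - k) (Suc k)) - scale (?c m k) (?A (m - k) (Suc k)))"
    by (simp add: sum.atMost_Suc_shift sum_subtractf del: sum.atMost_Suc)
  also have "\<dots> = ?A (Suc m) 0 + (\<Sum>k\<le>m. scale (?c (Suc m) (Suc k)) (?A (m - k) (Suc k)))"
    by (intro arg_cong2[of _ _ _ _ "(+)"] sum.cong refl)
      (simp add: algebra_simps scale_left_distrib)
  also have "\<dots> = (\<Sum>k\<le>Suc m. scale (?c (Suc m) k) (?A (Suc m - k) k))"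
    by (simp add: sum.atMost_Suc_shift del: sum.atMost_Suc)
  finally show ?case .
qed simp

text \<open>The inner binomial coefficients are divisible by \<open>p\<close>.\<close>

lemma commuting_diff_power_prime_char:
  assumes P: "Vector_Spaces.linear scale scale P" and Q: "Vector_Spaces.linear scale scale Q"
    and comm: "\<And>v. P (Q v) = Q (P v)"
    and p: "prime p" and char: "CHAR('a) = p"
  shows "((\<lambda>v. P v - Q v) ^^ p) v = (P ^^ p) v - (Q ^^ p) v"
proof -
  let ?t = "\<lambda>k. scale (of_nat (p choose k) * (- 1) ^ k) ((P ^^ (p - k)) ((Q ^^ k) v))"
  have p0: "0 < p" using p by (simp add: prime_gt_0_nat)
  have char0: "of_nat m = (0::'a) \<longleftrightarrow> p dvd m" for m
    using char of_nat_eq_0_iff_char_dvd by metis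
  \<comment> \<open>For \<open>p = 2\<close> the power is 1, which equals -1.\<close>
  have sign: "(- 1) ^ p = (- 1 :: 'a)"
  proof (cases "even p")
    case True
    then have "p = 2" using p primes_dvd_imp_eq two_is_prime_nat by blast
    then have "(1::'a) + 1 = 0" using char0[of 2] by simp
    then show ?thesis using \<open>p = 2\<close> by (simp add: eq_neg_iff_add_eq_0)
  qed simp
  have "?t k = 0" if "k \<in> {..p} - {0, p}" for k
  proof -
    have "p dvd (p choose k)" using that p by (intro dvd_choose_prime) auto
    then show ?thesis by (simp add: char0)
  qed
  then have "(\<Sum>k\<le>p. ?t k) = (\<Sum>k\<in>{0, p}. ?t k)"
    by (intro sum.mono_neutral_right) auto
  also have "\<dots> = (P ^^ p) v - (Q ^^ p) v"
    using p0 by (simp add: sign)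
  finally show ?thesis using commuting_diff_power[OF P Q comm, of p v] by simp
qed

lemma vector_space_fun: "vector_space (\<lambda>c f x. scale c (f x))"
  by unfold_locales (auto simp: scale_right_distrib scale_left_distrib)

text \<open>On families of forms indexed by a first argument, passing from the contractions of
  \<open>f\<close> to those of its Lie derivative is a difference of two commuting operators:
  \<open>?P\<close> differentiates each member, \<open>?Q\<close> applies \<open>D\<close> to the
  index. The p-th power of the difference is the difference of p-th powers; the rest is induction on
  the argument list.\<close>

lemma lie_der_power_prime_char:
  assumes a: "Vector_Spaces.linear scale scale a" and p: "prime p" and char: "CHAR('a) = p"
  shows "((lie_der a D) ^^ p) f = lie_der (a ^^ p) (D ^^ p) f"
proof
  interpret a: Vector_Spaces.linear scale scale a by (rule a)
  interpret F: vector_space "\<lambda>c f x. scale c (f x)" by (rule vector_space_fun)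
  interpret G: vector_space "\<lambda>c f x y. scale c (f x y)" by (rule F.vector_space_fun)
  let ?s = "\<lambda>c f x y. scale c (f x y)"
  let ?P = "\<lambda>(F :: 'c \<Rightarrow> 'c list \<Rightarrow> 'b) x. lie_der a D (F x)"
  let ?Q = "\<lambda>(F :: 'c \<Rightarrow> 'c list \<Rightarrow> 'b) x. F (D x)"
  have P: "Vector_Spaces.linear ?s ?s ?P" and Q: "Vector_Spaces.linear ?s ?s ?Q"
    unfolding Vector_Spaces.linear_iff using G.vector_space_axioms
    by (auto simp: fun_eq_iff lie_der_def a.add a.scale sum.distrib scale_sum_right
        scale_right_diff_distrib)
  have step: "?P (\<lambda>x. contract x f) - ?Q (\<lambda>x. contract x f) = (\<lambda>x. contract x (lie_der a D f))" for f
    by (intro ext) (simp add: contract_def[of _ "lie_der a D f"] contract_def[of "D _"] lie_der_Cons)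
  have pow: "((\<lambda>F. ?P F - ?Q F) ^^ m) (\<lambda>x. contract x f) = (\<lambda>x. contract x ((lie_der a D ^^ m) f))" for m f
    by (induction m) (simp, simp only: funpow.simps o_apply step)
  have Pp: "(?P ^^ m) F x = (lie_der a D ^^ m) (F x)" for m F x
    by (induction m arbitrary: F) simp_all
  have Qp: "(?Q ^^ m) F x = F ((D ^^ m) x)" for m F x
    by (induction m arbitrary: x F) (simp_all add: funpow_swap1)
  fix xs
  show "((lie_der a D) ^^ p) f xs = lie_der (a ^^ p) (D ^^ p) f xs"
  proof (induction xs arbitrary: f)
    case Nil
    have "((lie_der a D) ^^ m) f [] = (a ^^ m) (f [])" for m
      by (induction m) simp_all
    then show ?case by simp
  next
    case (Cons x xs)
    have "((lie_der a D) ^^ p) f (x # xs) = ((\<lambda>F. ?P F - ?Q F) ^^ p) (\<lambda>x. contract x f) x xs"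
      by (simp only: pow) (simp add: contract_def)
    also have "\<dots> = (?P ^^ p) (\<lambda>x. contract x f) x xs - (?Q ^^ p) (\<lambda>x. contract x f) x xs"
      by (subst G.commuting_diff_power_prime_char[OF P Q _ p char]) simp_all
    also have "\<dots> = lie_der (a ^^ p) (D ^^ p) f (x # xs)"
      by (simp add: Pp Qp Cons.IH lie_der_Cons) (simp add: contract_def)
    finally show ?case .
  qed
qed

text \<open>The commuting operators are now composition with \<open>a\<close> on the left and on the
  right, so this is the identity \<open>(ad a)^p = ad (a^p)\<close>.\<close>

lemma commutator_power_prime_char:
  assumes a: "Vector_Spaces.linear scale scale a" and p: "prime p" and char: "CHAR('a) = p"
    and comm: "\<And>y m. a (b y m) - b y (a m) = b (D y) m"
  shows "(a ^^ p) (b y m) - b y ((a ^^ p) m) = b ((D ^^ p) y) m"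
proof -
  interpret a: Vector_Spaces.linear scale scale a by (rule a)
  interpret F: vector_space "\<lambda>c f x. scale c (f x)" by (rule vector_space_fun)
  interpret G: vector_space "\<lambda>c f x y. scale c (f x y)" by (rule F.vector_space_fun)
  let ?s = "\<lambda>c f x y. scale c (f x y)"
  let ?P = "\<lambda>(F :: 'c \<Rightarrow> 'b \<Rightarrow> 'b) y m. a (F y m)"
  let ?Q = "\<lambda>(F :: 'c \<Rightarrow> 'b \<Rightarrow> 'b) y m. F y (a m)"
  have P: "Vector_Spaces.linear ?s ?s ?P" and Q: "Vector_Spaces.linear ?s ?s ?Q"
    unfolding Vector_Spaces.linear_iff using G.vector_space_axioms
    by (auto simp: fun_eq_iff a.add a.scale)
  have pow: "((\<lambda>F. ?P F - ?Q F) ^^ n) b = (\<lambda>y. b ((D ^^ n) y))" for n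
    by (induction n) (auto simp: fun_eq_iff comm)
  have Pp: "(?P ^^ n) F y m = (a ^^ n) (F y m)" for n F y m
    by (induction n arbitrary: F) simp_all
  have Qp: "(?Q ^^ n) F y m = F y ((a ^^ n) m)" for n F y m
    by (induction n arbitrary: F m) (simp_all add: funpow_swap1)
  have "((\<lambda>F. ?P F - ?Q F) ^^ p) b y m = ((?P ^^ p) b - (?Q ^^ p) b) y m"
    by (subst G.commuting_diff_power_prime_char[OF P Q _ p char]) simp_all
  then show ?thesis by (simp add: pow Pp Qp)
qed

end

section \<open>A faithful module of the Poincare--Birkhoff--Witt type\<close>

definition lincomb ::
    "('k::field \<Rightarrow> 'v::ab_group_add \<Rightarrow> 'v) \<Rightarrow> ('i \<Rightarrow> 'v) \<Rightarrow> ('i \<Rightarrow>\<^sub>0 'k) \<Rightarrow> 'v" where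
  "lincomb scale F v = (\<Sum>i\<in>Poly_Mapping.keys v. scale (Poly_Mapping.lookup v i) (F i))"

context vector_space
begin

lemma lincomb_superset:
  "finite A \<Longrightarrow> Poly_Mapping.keys v \<subseteq> A \<Longrightarrow>
    lincomb scale F v = (\<Sum>i\<in>A. scale (Poly_Mapping.lookup v i) (F i))"
  for v :: "'i \<Rightarrow>\<^sub>0 'a"
  unfolding lincomb_def by (rule sum.mono_neutral_left) (auto simp: in_keys_iff)

lemma lincomb_single [simp]: "lincomb scale F (Poly_Mapping.single i c) = scale c (F i)"
  by (simp add: lincomb_def)

lemma lincomb_0 [simp]: "lincomb scale F 0 = 0"
  by (simp add: lincomb_def)

lemma lincomb_add: "lincomb scale F (v + w) = lincomb scale F v + lincomb scale F w"
proof -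
  let ?A = "Poly_Mapping.keys v \<union> Poly_Mapping.keys w"
  have "lincomb scale F (v + w) = (\<Sum>i\<in>?A. scale (Poly_Mapping.lookup (v + w) i) (F i))"
    by (rule lincomb_superset) (simp_all add: keys_add)
  also have "\<dots> = lincomb scale F v + lincomb scale F w"
    by (simp add: lincomb_superset[of ?A] lookup_add scale_left_distrib sum.distrib)
  finally show ?thesis .
qed

lemma lincomb_diff: "lincomb scale F (v - w) = lincomb scale F v - lincomb scale F w"
  using lincomb_add[of F "v - w" w] by simp

lemma lincomb_const_mult: "lincomb scale F (Poly_Mapping.single 0 c * v) = scale c (lincomb scale F v)"
  for v :: "'i::monoid_add \<Rightarrow>\<^sub>0 'a"
proof -
  have lk: "Poly_Mapping.lookup (Poly_Mapping.single 0 c * v) i = c * Poly_Mapping.lookup v i" for i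
    by (simp add: Poly_Mapping.map.rep_eq when_def flip: mult_map_scale_conv_mult)
  have "Poly_Mapping.keys (Poly_Mapping.single 0 c * v) \<subseteq> Poly_Mapping.keys v"
    by (auto simp: in_keys_iff lk)
  then show ?thesis
    by (simp add: lincomb_superset[of "Poly_Mapping.keys v"] lk scale_sum_right)
qed

lemma lincomb_cong:
  "(\<And>i. i \<in> Poly_Mapping.keys v \<Longrightarrow> F i = G i) \<Longrightarrow> lincomb scale F v = lincomb scale G v"
  by (simp add: lincomb_def)

end

lemma poly_mapping_sum_singles:
  fixes v :: "'i \<Rightarrow>\<^sub>0 'k::comm_monoid_add"
  shows
  "v = (\<Sum>i\<in>Poly_Mapping.keys v. Poly_Mapping.single i (Poly_Mapping.lookup v i))"
proof (rule poly_mapping_eqI)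
  fix k
  show "Poly_Mapping.lookup v k = Poly_Mapping.lookup
      (\<Sum>i\<in>Poly_Mapping.keys v. Poly_Mapping.single i (Poly_Mapping.lookup v i)) k"
    by (cases "k \<in> Poly_Mapping.keys v")
      (auto simp: lookup_sum lookup_single when_def in_keys_iff sum.delta)
qed

lemma poly_mapping_linear_induct [case_names zero single add]:
  fixes v :: "'i \<Rightarrow>\<^sub>0 'k::comm_monoid_add"
  assumes "P 0" "\<And>i c. P (Poly_Mapping.single i c)" "\<And>v w. P v \<Longrightarrow> P w \<Longrightarrow> P (v + w)"
  shows "P v"
proof -
  have "P (\<Sum>i\<in>A. Poly_Mapping.single i (Poly_Mapping.lookup v i))" if "finite A" for A
    using that by (induction A rule: finite_induct) (auto simp: assms)
  then show ?thesis by (subst poly_mapping_sum_singles) simp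
qed

text \<open>The polynomial ring in variables indexed by the natural numbers: multisets of indices
  are monomials, and their sum is the product of monomials.\<close>

type_synonym 'k pbw_module = "nat multiset \<Rightarrow>\<^sub>0 'k"

definition pbw_scale :: "'k \<Rightarrow> 'k pbw_module \<Rightarrow> 'k::field pbw_module" where
  "pbw_scale c v = Poly_Mapping.single 0 c * v"

interpretation pbw: vector_space "pbw_scale :: 'k::field \<Rightarrow> _"
proof
  fix a b :: 'k and x y :: "'k pbw_module"
  show "pbw_scale a (pbw_scale b x) = pbw_scale (a * b) x"
    by (simp add: pbw_scale_def mult_single flip: mult.assoc)
qed (simp_all add: pbw_scale_def distrib_left distrib_right single_add)

abbreviation pbw_monom :: "nat multiset \<Rightarrow> 'k::field pbw_module" where
  "pbw_monom M \<equiv> Poly_Mapping.single M 1"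

lemma pbw_scale_monom: "pbw_scale c (pbw_monom M) = Poly_Mapping.single M c"
  by (simp add: pbw_scale_def mult_single)

lemma lincomb_pbw_scale: "lincomb s F (pbw_scale c v) = s c (lincomb s F v)"
  if "vector_space s"
  unfolding pbw_scale_def by (rule vector_space.lincomb_const_mult[OF that])

definition pbw_filtration :: "nat \<Rightarrow> 'k::field pbw_module set" where
  "pbw_filtration m = {v. \<forall>M\<in>Poly_Mapping.keys v. size M \<le> m}"

lemma subspace_pbw_filtration: "pbw.subspace (pbw_filtration m)"
proof (rule pbw.subspaceI)
  show "x + y \<in> pbw_filtration m"
    if "x \<in> pbw_filtration m" "y \<in> pbw_filtration m" for x y :: "'a pbw_module"
    using that keys_add[of x y] by (auto simp: pbw_filtration_def)
  show "pbw_scale c x \<in> pbw_filtration m" if "x \<in> pbw_filtration m" for c and x :: "'a pbw_module"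
    using that keys_mult[of "Poly_Mapping.single 0 c" x]
    by (auto simp: pbw_filtration_def pbw_scale_def split: if_splits)
qed (simp add: pbw_filtration_def)

lemma pbw_filtration_mono: "v \<in> pbw_filtration m \<Longrightarrow> m \<le> n \<Longrightarrow> v \<in> pbw_filtration n"
  by (auto simp: pbw_filtration_def)

lemma pbw_monom_filtration: "size M \<le> m \<Longrightarrow> pbw_monom M \<in> pbw_filtration m"
  by (simp add: pbw_filtration_def)

lemma lincomb_filtration:
  assumes "\<And>M. M \<in> Poly_Mapping.keys v \<Longrightarrow> F M \<in> pbw_filtration m"
  shows "lincomb pbw_scale F v \<in> pbw_filtration m"
  unfolding lincomb_def
  using subspace_pbw_filtration assms by (intro pbw.subspace_sum pbw.subspace_scale)

section \<open>The action of a Lie algebra with ordered basis on polynomials\<close>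

locale lie_algebra_basis = lie_algebra scale bracket
  for scale :: "'k::field \<Rightarrow> 'a::ab_group_add \<Rightarrow> 'a" and bracket :: "'a \<Rightarrow> 'a \<Rightarrow> 'a" +
  fixes e :: "nat \<Rightarrow> 'a" and d :: nat
  assumes e_inj: "inj_on e {..<d}" and e_indep: "independent (e ` {..<d})"
    and e_span: "span (e ` {..<d}) = UNIV"
begin

definition coord :: "'a \<Rightarrow> nat \<Rightarrow> 'k" where
  "coord x i = representation (e ` {..<d}) x (e i)"

lemma coord_add: "coord (x + y) i = coord x i + coord y i"
  unfolding coord_def by (subst representation_add[OF e_indep]) (simp_all add: e_span)

lemma coord_scale: "coord (scale c x) i = c * coord x i"
  unfolding coord_def by (subst representation_scale[OF e_indep]) (simp_all add: e_span)

lemma coord_e: "i < d \<Longrightarrow> j < d \<Longrightarrow> coord (e i) j = (if i = j then 1 else 0)"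
  unfolding coord_def using e_inj by (subst representation_basis[OF e_indep]) (auto simp: inj_on_def)

lemma sum_coord: "(\<Sum>i<d. scale (coord x i) (e i)) = x"
proof -
  have "(\<Sum>b\<in>e ` {..<d}. scale (representation (e ` {..<d}) x b) b) = x"
    by (rule sum_representation_eq[OF e_indep]) (simp_all add: e_span)
  then show ?thesis by (simp add: sum.reindex[OF e_inj] coord_def)
qed

text \<open>
  The action of the basis vector \<open>e i\<close> on the monomial \<open>M\<close>, to be used for monomials of degree at
  most the first argument. It is determined by requiring \<open>e i \<cdot> M = e\<^sub>i M\<close> if \<open>i \<le> M\<close> and
  \<open>e i \<cdot> (e j \<cdot> N) = e j \<cdot> (e i \<cdot> N) + [e i, e j] \<cdot> N\<close> if \<open>M = e\<^sub>j N\<close> with \<open>j < i\<close>, \<open>j \<le> N\<close>.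
  As \<open>e j \<cdot> (e\<^sub>i N) = e\<^sub>j e\<^sub>i N\<close>, the recursion is only needed on \<open>e i \<cdot> N - e\<^sub>i N\<close>, of lower degree.
\<close>

primrec pbw_raw :: "nat \<Rightarrow> nat \<Rightarrow> nat multiset \<Rightarrow> 'k pbw_module" where
  "pbw_raw 0 i M = pbw_monom (add_mset i M)"
| "pbw_raw (Suc n) i M =
     (if \<forall>j\<in>#M. i \<le> j then pbw_monom (add_mset i M)
      else let j = Min_mset M; N = M - {#j#} in
        pbw_monom (add_mset i M) +
        lincomb pbw_scale (pbw_raw n j) (pbw_raw n i N - pbw_monom (add_mset i N)) +
        (\<Sum>k<d. pbw_scale (coord (bracket (e i) (e j)) k) (pbw_raw n k N)))"

lemma size_remove_Min:
  "\<not> (\<forall>j\<in>#M. i \<le> j) \<Longrightarrow> size M = Suc (size (M - {#Min_mset M#}))" for M :: "nat multiset"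
  by (metis Min_in finite_set_mset insert_DiffM set_mset_eq_empty_iff size_add_mset empty_iff)

text \<open>The product monomial is the leading term of the action. Hence the difference fed into
  the recursion has degree at most that of \<open>N\<close>, and the recursion meets only monomials
  of lower degree than \<open>M\<close>.\<close>

lemma pbw_raw_filtration:
  assumes "size M \<le> n"
  shows "pbw_raw n i M - pbw_monom (add_mset i M) \<in> pbw_filtration (size M)"
  using assms
proof (induction n arbitrary: i M)
  case 0
  then show ?case by (simp add: pbw_filtration_def)
next
  case (Suc n)
  show ?case
  proof (cases "\<forall>j\<in>#M. i \<le> j")
    case True
    then show ?thesis by (simp add: pbw_filtration_def)
  next
    case False
    define j where "j = Min_mset M"
    define N where "N = M - {#j#}"
    have sN: "size M = Suc (size N)" using size_remove_Min[OF False] by (simp add: N_def j_def)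
    have raw: "pbw_raw n k K \<in> pbw_filtration (size M)" if "size K \<le> size N" for k K
    proof -
      have "pbw_raw n k K - pbw_monom (add_mset k K) \<in> pbw_filtration (size M)"
        using Suc.IH[of K k] that sN Suc.prems by (auto intro: pbw_filtration_mono)
      moreover have "pbw_monom (add_mset k K) \<in> pbw_filtration (size M)"
        using that sN by (simp add: pbw_monom_filtration)
      ultimately show ?thesis
        using pbw.subspace_add[OF subspace_pbw_filtration] by fastforce
    qed
    have w: "pbw_raw n i N - pbw_monom (add_mset i N) \<in> pbw_filtration (size N)"
      using Suc.IH[of N i] sN Suc.prems by simp
    have "lincomb pbw_scale (pbw_raw n j) (pbw_raw n i N - pbw_monom (add_mset i N)) \<in> pbw_filtration (size M)"
      using w by (intro lincomb_filtration raw) (auto simp: pbw_filtration_def)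
    moreover have "(\<Sum>k<d. pbw_scale (coord (bracket (e i) (e j)) k) (pbw_raw n k N)) \<in> pbw_filtration (size M)"
      using raw by (intro pbw.subspace_sum pbw.subspace_scale subspace_pbw_filtration) auto
    ultimately show ?thesis
      using pbw.subspace_add[OF subspace_pbw_filtration]
      unfolding pbw_raw.simps if_not_P[OF False] Let_def j_def[symmetric] N_def[symmetric]
      by (simp add: add.assoc)
  qed
qed

text \<open>The first argument only bounds the recursion depth; recursive calls concern monomials of
  lower degree, so every large enough bound gives the same value.\<close>

lemma pbw_raw_stable: "size M \<le> n \<Longrightarrow> pbw_raw (Suc n) i M = pbw_raw n i M"
proof (induction n arbitrary: i M)
  case (Suc n)
  show ?case
  proof (cases "\<forall>j\<in>#M. i \<le> j")
    case False
    define j where "j = Min_mset M"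
    define N where "N = M - {#j#}"
    have sN: "size N \<le> n" using size_remove_Min[OF False] Suc.prems by (simp add: N_def j_def)
    have N: "pbw_raw (Suc n) k N = pbw_raw n k N" for k by (rule Suc.IH[OF sN])
    have lin: "lincomb pbw_scale (pbw_raw (Suc n) j) (pbw_raw n i N - pbw_monom (add_mset i N)) =
        lincomb pbw_scale (pbw_raw n j) (pbw_raw n i N - pbw_monom (add_mset i N))"
      using pbw_raw_filtration[OF sN, of i] sN
      by (intro pbw.lincomb_cong Suc.IH) (auto simp: pbw_filtration_def)
    have u: "pbw_raw (Suc m) i M =
        pbw_monom (add_mset i M) +
        lincomb pbw_scale (pbw_raw m j) (pbw_raw m i N - pbw_monom (add_mset i N)) +
        (\<Sum>k<d. pbw_scale (coord (bracket (e i) (e j)) k) (pbw_raw m k N))" for m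
      unfolding pbw_raw.simps if_not_P[OF False] Let_def j_def N_def ..
    show ?thesis by (simp only: u N lin)
  qed simp
qed simp

definition pbw_op :: "nat \<Rightarrow> 'k pbw_module \<Rightarrow> 'k pbw_module" where
  "pbw_op i = lincomb pbw_scale (\<lambda>M. pbw_raw (size M) i M)"

definition pbw_act :: "'a \<Rightarrow> 'k pbw_module \<Rightarrow> 'k pbw_module" where
  "pbw_act x v = (\<Sum>i<d. pbw_scale (coord x i) (pbw_op i v))"

lemma pbw_raw_eq: "size M \<le> n \<Longrightarrow> pbw_raw n i M = pbw_op i (pbw_monom M)"
proof (induction n)
  case (Suc n)
  then show ?case
    by (cases "size M = Suc n") (simp_all add: pbw_op_def pbw_raw_stable del: pbw_raw.simps)
qed (simp add: pbw_op_def del: single_one)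

lemma pbw_op_add: "pbw_op i (v + w) = pbw_op i v + pbw_op i w"
  and pbw_op_diff: "pbw_op i (v - w) = pbw_op i v - pbw_op i w"
  and pbw_op_scale: "pbw_op i (pbw_scale c v) = pbw_scale c (pbw_op i v)"
  by (simp_all add: pbw_op_def pbw.lincomb_add pbw.lincomb_diff lincomb_pbw_scale pbw.vector_space_axioms)

lemma linear_pbw_act_right: "Vector_Spaces.linear pbw_scale pbw_scale (\<lambda>v. pbw_act x v)"
  by (simp add: Vector_Spaces.linear_iff pbw.vector_space_axioms pbw_act_def pbw_op_add pbw_op_scale
      pbw.scale_right_distrib sum.distrib pbw.scale_sum_right mult.commute)

lemma linear_pbw_act_left: "Vector_Spaces.linear scale pbw_scale (\<lambda>x. pbw_act x v)"
  by (simp add: Vector_Spaces.linear_iff pbw.vector_space_axioms vector_space_axioms pbw_act_def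
      coord_add coord_scale pbw.scale_left_distrib sum.distrib pbw.scale_sum_right)

lemma pbw_act_e: "i < d \<Longrightarrow> pbw_act (e i) v = pbw_op i v"
proof -
  assume i: "i < d"
  have "pbw_act (e i) v = (\<Sum>j<d. if i = j then pbw_op j v else 0)"
    unfolding pbw_act_def using i by (intro sum.cong) (auto simp: coord_e)
  then show ?thesis using i by simp
qed

lemma pbw_op_monom:
  assumes "\<forall>j\<in>#M. i \<le> j"
  shows "pbw_op i (pbw_monom M) = pbw_monom (add_mset i M)"
  using assms pbw_raw_eq[of M "Suc (size M)" i] by simp

lemma pbw_op_filtration:
  "pbw_op i (pbw_monom M) - pbw_monom (add_mset i M) \<in> pbw_filtration (size M)"
  using pbw_raw_filtration[of M "size M" i] by (simp add: pbw_raw_eq)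

text \<open>The recursion for \<open>add_mset j N\<close>, whose least index is \<open>j\<close>,
  solved for the commutator.\<close>

lemma pbw_op_commute_smaller:
  assumes N: "\<forall>k\<in>#N. j \<le> k" and ji: "j < i"
  shows "pbw_op i (pbw_op j (pbw_monom N)) =
    pbw_op j (pbw_op i (pbw_monom N)) + pbw_act (bracket (e i) (e j)) (pbw_monom N)"
proof -
  let ?M = "add_mset j N"
  have min: "Min_mset ?M = j" using N by (auto intro!: Min_eqI)
  have not: "\<not> (\<forall>k\<in>#?M. i \<le> k)" using ji by auto
  define w where "w = pbw_op i (pbw_monom N) - pbw_monom (add_mset i N)"
  have w: "lincomb pbw_scale (pbw_raw (size N) j) w = pbw_op j w"
    using pbw_op_filtration[of i N] unfolding pbw_op_def w_def[symmetric]
    by (intro pbw.lincomb_cong) (auto simp: pbw_filtration_def pbw_raw_eq simp flip: w_def)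
  have "pbw_op i (pbw_op j (pbw_monom N)) = pbw_op i (pbw_monom ?M)"
    using N by (simp add: pbw_op_monom)
  also have "\<dots> = pbw_raw (Suc (size N)) i ?M"
    by (rule pbw_raw_eq[symmetric]) simp
  also have "\<dots> = pbw_monom (add_mset i ?M) + pbw_op j w + pbw_act (bracket (e i) (e j)) (pbw_monom N)"
    unfolding pbw_raw.simps if_not_P[OF not] Let_def min
    by (simp add: pbw_raw_eq pbw_act_def w flip: w_def)
  \<comment> \<open>As \<open>j\<close> is at most every index of \<open>add_mset i N\<close>, it
    acts there by multiplication.\<close>
  also have "pbw_op j w = pbw_op j (pbw_op i (pbw_monom N)) - pbw_monom (add_mset i ?M)"
    using N ji by (simp add: w_def pbw_op_diff pbw_op_monom add_mset_commute)
  finally show ?thesis by simp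
qed

lemma pbw_act_add: "pbw_act x (v + w) = pbw_act x v + pbw_act x w"
  and pbw_act_diff: "pbw_act x (v - w) = pbw_act x v - pbw_act x w"
  and pbw_act_scale: "pbw_act x (pbw_scale c v) = pbw_scale c (pbw_act x v)"
  and pbw_act_add_left: "pbw_act (x + y) v = pbw_act x v + pbw_act y v"
  and pbw_act_diff_left: "pbw_act (x - y) v = pbw_act x v - pbw_act y v"
  and pbw_act_scale_left: "pbw_act (scale c x) v = pbw_scale c (pbw_act x v)"
proof -
  interpret r: Vector_Spaces.linear pbw_scale pbw_scale "\<lambda>v. pbw_act x v" for x
    by (rule linear_pbw_act_right)
  interpret l: Vector_Spaces.linear scale pbw_scale "\<lambda>x. pbw_act x v" for v
    by (rule linear_pbw_act_left)
  show "pbw_act x (v + w) = pbw_act x v + pbw_act x w"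
    "pbw_act x (v - w) = pbw_act x v - pbw_act x w"
    "pbw_act x (pbw_scale c v) = pbw_scale c (pbw_act x v)"
    "pbw_act (x + y) v = pbw_act x v + pbw_act y v"
    "pbw_act (x - y) v = pbw_act x v - pbw_act y v"
    "pbw_act (scale c x) v = pbw_scale c (pbw_act x v)"
    by (simp_all add: r.add r.diff r.scale l.add l.diff l.scale)
qed

lemma pbw_act_zero_left: "pbw_act 0 v = 0"
  and pbw_act_minus_left: "pbw_act (- x) v = - pbw_act x v"
  using pbw_act_diff_left[of 0 0 v] pbw_act_diff_left[of 0 x v] by simp_all

lemmas pbw_act_simps = pbw_act_add pbw_act_diff pbw_act_scale
  pbw_act_add_left pbw_act_diff_left pbw_act_scale_left

text \<open>The defect of the relation is linear in \<open>x\<close>, \<open>y\<close> and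
  \<open>v\<close>, so basis vectors and monomials suffice.\<close>

lemma pbw_act_commutatorI:
  assumes "\<And>M i j. M \<in> Poly_Mapping.keys v \<Longrightarrow> i < d \<Longrightarrow> j < d \<Longrightarrow>
    pbw_op i (pbw_op j (pbw_monom M)) - pbw_op j (pbw_op i (pbw_monom M)) =
    pbw_act (bracket (e i) (e j)) (pbw_monom M)"
  shows "pbw_act x (pbw_act y v) - pbw_act y (pbw_act x v) = pbw_act (bracket x y) v"
proof -
  interpret V: vector_space_pair scale "pbw_scale :: 'k \<Rightarrow> _" by unfold_locales
  let ?c = "\<lambda>x y v. pbw_act x (pbw_act y v) - pbw_act y (pbw_act x v) - pbw_act (bracket x y) v"
  have lx: "Vector_Spaces.linear scale pbw_scale (\<lambda>x. ?c x y v)" for y v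
    by (simp add: V.linear_iff pbw_act_simps pbw.scale_right_diff_distrib)
  have ly: "Vector_Spaces.linear scale pbw_scale (\<lambda>y. ?c x y v)" for x v
    by (simp add: V.linear_iff pbw_act_simps pbw.scale_right_diff_distrib)
  have mon: "?c x y (pbw_monom M) = 0" if M: "M \<in> Poly_Mapping.keys v" for x y M
  proof (rule V.linear_eq_0_on_span[OF lx])
    fix b assume "b \<in> e ` {..<d}"
    then obtain i where i: "i < d" "b = e i" by auto
    show "?c b y (pbw_monom M) = 0"
    proof (rule V.linear_eq_0_on_span[OF ly])
      fix b' assume "b' \<in> e ` {..<d}"
      then show "?c b b' (pbw_monom M) = 0"
        using assms[OF M] i by (auto simp: pbw_act_e)
    qed (simp add: e_span)
  qed (simp add: e_span)
  interpret c: Vector_Spaces.linear pbw_scale pbw_scale "?c x y"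
    by (simp add: Vector_Spaces.linear_iff pbw.vector_space_axioms pbw_act_simps
        pbw.scale_right_diff_distrib)
  have "v = (\<Sum>M\<in>Poly_Mapping.keys v. pbw_scale (Poly_Mapping.lookup v M) (pbw_monom M))"
    unfolding pbw_scale_monom by (rule poly_mapping_sum_singles)
  then have "?c x y v = (\<Sum>M\<in>Poly_Mapping.keys v. pbw_scale (Poly_Mapping.lookup v M) (?c x y (pbw_monom M)))"
    by (metis (no_types, lifting) c.sum c.scale sum.cong)
  also have "\<dots> = 0" by (rule sum.neutral) (simp add: mon)
  finally show ?thesis by simp
qed

text \<open>If \<open>i\<close> and \<open>j\<close> differ and the smaller is at most every index
  of \<open>N\<close>, this is the recursion. If some index of \<open>N\<close> is below both, the
  least index \<open>k\<close> is split off, commutators with \<open>e k\<close> are evaluated by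
  the recursion or in lower degree, and the Jacobi identity assembles the result.\<close>

lemma pbw_op_commutator:
  assumes IH: "\<And>m v x y. m < size N \<Longrightarrow> v \<in> pbw_filtration m \<Longrightarrow>
      pbw_act x (pbw_act y v) - pbw_act y (pbw_act x v) = pbw_act (bracket x y) v"
    and d: "i < d" "j < d"
  shows "pbw_op i (pbw_op j (pbw_monom N)) - pbw_op j (pbw_op i (pbw_monom N)) =
    pbw_act (bracket (e i) (e j)) (pbw_monom N)"
proof -
  consider "i = j" | "j < i" "\<forall>k\<in>#N. j \<le> k" | "i < j" "\<forall>k\<in>#N. i \<le> k"
    | k where "k \<in># N" "k < min i j"
    by (cases i j rule: linorder_cases; cases "\<forall>k\<in>#N. min i j \<le> k") (auto simp: not_le)
  then show ?thesis
  proof cases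
    case 1
    then show ?thesis by (simp add: pbw_act_zero_left)
  next
    case 2
    then show ?thesis by (simp add: pbw_op_commute_smaller)
  next
    case 3
    then show ?thesis
      by (simp add: pbw_op_commute_smaller bracket_antisym[of "e i" "e j"] pbw_act_minus_left)
  next
    case 4
    define k where "k = Min_mset N"
    define P where "P = N - {#k#}"
    have kN: "k \<in># N" using 4 by (auto simp: k_def intro!: Min_in)
    then have N: "N = add_mset k P" by (simp add: P_def)
    have kP: "\<forall>l\<in>#P. k \<le> l" by (auto simp: k_def P_def dest: in_diffD)
    have "k < min i j"
      using le_less_trans[OF Min_le[OF finite_set_mset 4(1)] 4(2)] by (simp only: k_def)
    then have k: "k < i" "k < j" "k < d" using d by simp_all
    let ?z = "pbw_monom P"
    let ?T = "\<lambda>x. pbw_act x"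
    have zN: "pbw_monom N = pbw_op k ?z" using kP by (simp add: N pbw_op_monom)
    have low: "?T x (?T y v) = ?T y (?T x v) + ?T (bracket x y) v"
      if "v \<in> pbw_filtration (size P)" for v x y
      using IH[OF _ that, of x y] by (simp add: N algebra_simps)
    have z: "?z \<in> pbw_filtration (size P)" by (simp add: pbw_monom_filtration)
    \<comment> \<open>The operator of \<open>e k\<close> is moved to the left. To pass it across
      that of \<open>e i\<close>, the vector \<open>?T (e j) ?z\<close> is split into its leading
      monomial, where the recursion applies, and a rest \<open>w\<close> covered by
      \<open>IH\<close>.\<close>
    have main: "pbw_op i (pbw_op j (pbw_monom N)) =
        ?T (e k) (?T (e i) (?T (e j) ?z)) + ?T (bracket (e i) (e k)) (?T (e j) ?z) +
        ?T (bracket (e j) (e k)) (?T (e i) ?z) + ?T (bracket (e i) (bracket (e j) (e k))) ?z"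
      if ij: "i < d" "j < d" "k < i" "k < j" for i j
    proof -
      define w where "w = ?T (e j) ?z - pbw_monom (add_mset j P)"
      have w: "w \<in> pbw_filtration (size P)"
        using pbw_op_filtration[of j P] ij by (simp add: w_def pbw_act_e)
      have Tz: "?T (e j) ?z = pbw_monom (add_mset j P) + w" by (simp add: w_def)
      have "?T (e i) (?T (e k) (pbw_monom (add_mset j P))) =
          ?T (e k) (?T (e i) (pbw_monom (add_mset j P))) + ?T (bracket (e i) (e k)) (pbw_monom (add_mset j P))"
        using pbw_op_commute_smaller[of "add_mset j P" k i] kP ij k(3) by (simp add: pbw_act_e)
      then have swap: "?T (e i) (?T (e k) (?T (e j) ?z)) =
          ?T (e k) (?T (e i) (?T (e j) ?z)) + ?T (bracket (e i) (e k)) (?T (e j) ?z)"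
        unfolding Tz using low[OF w, of "e i" "e k"] by (simp add: pbw_act_simps)
      have "pbw_op i (pbw_op j (pbw_monom N)) = ?T (e i) (?T (e j) (?T (e k) ?z))"
        using ij k(3) by (simp add: zN pbw_act_e)
      also have "\<dots> = ?T (e i) (?T (e k) (?T (e j) ?z)) + ?T (e i) (?T (bracket (e j) (e k)) ?z)"
        using low[OF z, of "e j" "e k"] by (simp add: pbw_act_simps)
      also have "?T (e i) (?T (bracket (e j) (e k)) ?z) =
          ?T (bracket (e j) (e k)) (?T (e i) ?z) + ?T (bracket (e i) (bracket (e j) (e k))) ?z"
        by (rule low[OF z])
      finally show ?thesis unfolding swap by (simp add: algebra_simps)
    qed
    have "?T (bracket (e i) (e j)) (pbw_monom N) = ?T (e k) (?T (bracket (e i) (e j)) ?z) +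
        ?T (bracket (bracket (e i) (e j)) (e k)) ?z"
      using low[OF z, of "bracket (e i) (e j)" "e k"] k(3) by (simp add: zN pbw_act_e)
    also have "?T (bracket (e i) (e j)) ?z = ?T (e i) (?T (e j) ?z) - ?T (e j) (?T (e i) ?z)"
      using low[OF z, of "e i" "e j"] by simp
    also have "bracket (bracket (e i) (e j)) (e k) =
        bracket (e i) (bracket (e j) (e k)) - bracket (e j) (bracket (e i) (e k))"
      using bracket_derivation[of "e i" "e j" "e k"] by simp
    \<comment> \<open>The two middle terms of \<open>main\<close> are interchanged with
      \<open>i\<close> and \<open>j\<close> and drop out of the difference; the double brackets
      match by the Jacobi identity.\<close>
    finally show ?thesis
      using main[OF d k(1,2)] main[OF d(2,1) k(2,1)] by (simp add: pbw_act_simps)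
  qed
qed

lemma pbw_act_commutator:
  assumes "v \<in> pbw_filtration m"
  shows "pbw_act x (pbw_act y v) - pbw_act y (pbw_act x v) = pbw_act (bracket x y) v"
  using assms
proof (induction m arbitrary: v x y rule: less_induct)
  case (less m)
  show ?case
  proof (rule pbw_act_commutatorI)
    fix M i j assume M: "M \<in> Poly_Mapping.keys v" and d: "i < d" "j < d"
    have "size M \<le> m" using M less.prems by (auto simp: pbw_filtration_def)
    then show "pbw_op i (pbw_op j (pbw_monom M)) - pbw_op j (pbw_op i (pbw_monom M)) =
        pbw_act (bracket (e i) (e j)) (pbw_monom M)"
      using less.IH by (intro pbw_op_commutator d) (meson order_less_le_trans)
  qed
qed

lemma pbw_lie_module: "lie_module scale bracket pbw_scale pbw_act"
proof unfold_locales
  show "pbw_act (bracket x y) v = pbw_act x (pbw_act y v) - pbw_act y (pbw_act x v)" for x y v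
  proof -
    have "v \<in> pbw_filtration (Max (size ` Poly_Mapping.keys v))"
      by (auto simp: pbw_filtration_def)
    then show ?thesis using pbw_act_commutator by metis
  qed
qed (use linear_pbw_act_right linear_pbw_act_left in \<open>simp_all add: Vector_Spaces.linear_iff\<close>)

text \<open>Acting on the unit monomial displays the coordinates of \<open>x\<close> as linear
  coefficients. This faithfulness supplies the needed injectivity of L into U(L).\<close>

lemma pbw_act_one_eq_0:
  assumes "pbw_act x (pbw_monom {#}) = 0"
  shows "x = 0"
proof -
  have "pbw_act x (pbw_monom {#}) = (\<Sum>i<d. Poly_Mapping.single {#i#} (coord x i))"
    by (simp add: pbw_act_def pbw_op_monom pbw_scale_monom del: single_one)
  then have "Poly_Mapping.lookup (\<Sum>i<d. Poly_Mapping.single {#i#} (coord x i)) {#j#} = 0" for j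
    using assms by simp
  then have "(if j < d then coord x j else 0) = 0" for j
    by (simp add: lookup_sum lookup_single when_def)
  then have "coord x j = 0" if "j < d" for j using that by meson
  then have "(\<Sum>i<d. scale (coord x i) (e i)) = 0" by simp
  then show ?thesis by (simp add: sum_coord)
qed

end

section \<open>The enveloping algebra and its action\<close>

context p_envelope
begin

lemma envelope_induct:
  assumes "p_subalgebra scaleE bracketE pmap S" "range \<iota> \<subseteq> S"
  shows "x \<in> S"
  using assms iota_generates by blast

lemma iota_simps:
  "\<iota> (x + y) = \<iota> x + \<iota> y" "\<iota> (scaleL c x) = scaleE c (\<iota> x)" "\<iota> 0 = 0"
proof -
  interpret i: Vector_Spaces.linear scaleL scaleE \<iota> by (rule iota_linear)
  show "\<iota> (x + y) = \<iota> x + \<iota> y" "\<iota> (scaleL c x) = scaleE c (\<iota> x)" "\<iota> 0 = 0"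
    by (simp_all add: i.add i.scale i.zero)
qed

lemma subspace_range_iota: "subspace (range \<iota>)"
proof (rule subspaceI)
  show "0 \<in> range \<iota>" using iota_simps(3) by (metis rangeI)
  show "x + y \<in> range \<iota>" if "x \<in> range \<iota>" "y \<in> range \<iota>" for x y
    using that by (auto simp flip: iota_simps(1))
  show "scaleE c x \<in> range \<iota>" if "x \<in> range \<iota>" for c x
    using that by (auto simp flip: iota_simps(2))
qed

lemma pmap_bracket: "bracketE (pmap x) y = (bracketE x ^^ p) y"
  by (simp add: pmap_ad)

lemma p_Suc: obtains q where "p = Suc q"
  using prime_gt_0_nat[OF prime_p] gr0_implies_Suc by blast

text \<open>The elements normalizing the image of L form a p-subalgebra, because the adjoint map of
  \<open>pmap x\<close> is a power of that of \<open>x\<close>.\<close>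

lemma bracket_range_iota:
  assumes "y \<in> range \<iota>"
  shows "bracketE x y \<in> range \<iota>"
proof -
  let ?S = "{x. \<forall>y\<in>range \<iota>. bracketE x y \<in> range \<iota>}"
  note sub = subspace_range_iota
  have "p_subalgebra scaleE bracketE pmap ?S"
    unfolding p_subalgebra_def
  proof (intro conjI ballI)
    show "subspace ?S"
      by (rule subspaceI) (use subspace_add[OF sub] subspace_scale[OF sub] subspace_0[OF sub] in auto)
    show "bracketE x x' \<in> ?S" if "x \<in> ?S" "x' \<in> ?S" for x x'
    proof (intro CollectI ballI)
      fix y assume y: "y \<in> range \<iota>"
      have "bracketE (bracketE x x') y = bracketE x (bracketE x' y) - bracketE x' (bracketE x y)"
        by (simp add: bracket_derivation[of x])
      moreover have "bracketE x (bracketE x' y) \<in> range \<iota>" "bracketE x' (bracketE x y) \<in> range \<iota>"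
        using that y by blast+
      ultimately show "bracketE (bracketE x x') y \<in> range \<iota>"
        using subspace_diff[OF sub] by simp
    qed
    show "pmap x \<in> ?S" if "x \<in> ?S" for x
    proof -
      have "(bracketE x ^^ m) y \<in> range \<iota>" if "y \<in> range \<iota>" for m y
        using \<open>x \<in> ?S\<close> that by (induction m) (simp, simp only: funpow.simps o_apply, blast)
      then show ?thesis by (simp add: pmap_bracket)
    qed
  qed
  moreover have "range \<iota> \<subseteq> ?S" by (auto simp flip: iota_bracket)
  ultimately show ?thesis using envelope_induct assms by blast
qed

text \<open>The elements whose brackets all lie in the image form a p-subalgebra: as
  \<open>p\<close> is positive, the outermost factor of the p-fold adjoint map already lands in the
  image. It contains the image by the previous lemma and antisymmetry.\<close>

lemma bracket_in_range_iota: "bracketE x y \<in> range \<iota>"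
proof -
  let ?S = "{x. \<forall>y. bracketE x y \<in> range \<iota>}"
  note sub = subspace_range_iota
  have "p_subalgebra scaleE bracketE pmap ?S"
    unfolding p_subalgebra_def
  proof (intro conjI ballI)
    show "subspace ?S"
      by (rule subspaceI) (use subspace_add[OF sub] subspace_scale[OF sub] subspace_0[OF sub] in auto)
    show "bracketE x x' \<in> ?S" if "x \<in> ?S" "x' \<in> ?S" for x x'
    proof (intro CollectI allI)
      fix y
      have "bracketE (bracketE x x') y = bracketE x (bracketE x' y) - bracketE x' (bracketE x y)"
        by (simp add: bracket_derivation[of x])
      then show "bracketE (bracketE x x') y \<in> range \<iota>"
        using that subspace_diff[OF sub] by auto
    qed
    show "pmap x \<in> ?S" if "x \<in> ?S" for x
    proof -
      have "(bracketE x ^^ Suc m) y \<in> range \<iota>" for m y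
        using that by (simp only: funpow.simps o_apply) blast
      then show ?thesis
        unfolding pmap_bracket mem_Collect_eq by (metis p_Suc)
    qed
  qed
  moreover have "bracketE x y \<in> range \<iota>" if "x \<in> range \<iota>" for x y
    unfolding bracket_antisym[of x y] by (rule subspace_neg[OF sub bracket_range_iota[OF that]])
  then have "range \<iota> \<subseteq> ?S" by blast
  ultimately show ?thesis using envelope_induct by blast
qed

text \<open>The centralizer of \<open>t\<close> is a p-subalgebra, by the Jacobi identity and the
  positivity of \<open>p\<close>.\<close>

lemma centralizer_range_iota:
  assumes t: "\<And>x. bracketE t (\<iota> x) = 0"
  shows "bracketE t y = 0"
proof -
  let ?S = "{y. bracketE y t = 0}"
  have "p_subalgebra scaleE bracketE pmap ?S"
    unfolding p_subalgebra_def
  proof (intro conjI ballI)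
    show "subspace ?S" by (rule subspaceI) auto
    show "bracketE x y \<in> ?S" if "x \<in> ?S" "y \<in> ?S" for x y
      using that bracket_derivation[of x y t] by simp
    show "pmap x \<in> ?S" if "x \<in> ?S" for x
    proof -
      have "(bracketE x ^^ Suc m) t = 0" for m
        using that by (induction m) auto
      then show ?thesis
        unfolding pmap_bracket mem_Collect_eq by (metis p_Suc)
    qed
  qed
  moreover have "range \<iota> \<subseteq> ?S"
    using t bracket_antisym[of _ t] by auto
  ultimately have "y \<in> ?S" using envelope_induct by blast
  then show ?thesis using bracket_antisym[of t y] by simp
qed

end

section \<open>The enveloping algebra, computed on representatives\<close>

lemma ring_free_alg_ring: "ring (free_alg_ring :: ('a, 'k::field) free_alg ring)"
proof (rule ringI)
  show "abelian_group (free_alg_ring :: ('a, 'k) free_alg ring)"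
  proof (rule abelian_groupI)
    fix x assume "x \<in> carrier (free_alg_ring :: ('a, 'k) free_alg ring)"
    show "\<exists>y\<in>carrier free_alg_ring. y \<oplus>\<^bsub>free_alg_ring\<^esub> x = \<zero>\<^bsub>free_alg_ring\<^esub>"
      by (rule bexI[of _ "- x"]) (simp_all add: free_alg_ring_def)
  qed (simp_all add: free_alg_ring_def algebra_simps)
  show "Group.monoid (free_alg_ring :: ('a, 'k) free_alg ring)"
    by (rule monoidI) (simp_all add: free_alg_ring_def mult.assoc)
qed (simp_all add: free_alg_ring_def algebra_simps)

context lie_algebra
begin

lemma ideal_enveloping: "ideal (enveloping_ideal scale bracket) free_alg_ring"
  unfolding enveloping_ideal_def
  by (rule ring.genideal_ideal[OF ring_free_alg_ring]) (simp add: free_alg_ring_def)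

lemma UEA_hom: "ring_hom_ring free_alg_ring (UEA scale bracket) (UEA_class scale bracket)"
proof -
  have "UEA_class scale bracket = a_r_coset free_alg_ring (enveloping_ideal scale bracket)"
    by (rule ext) (simp add: UEA_class_def)
  then show ?thesis
    unfolding UEA_def by (simp add: ideal.rcos_ring_hom_ring[OF ideal_enveloping])
qed

lemma UEA_carrier: "carrier (UEA scale bracket) = range (UEA_class scale bracket)"
  by (auto simp: UEA_def FactRing_def A_RCOSETS_defs UEA_class_def a_r_coset_def r_coset_def
      free_alg_ring_def)

lemma UEA_class_simps:
  "UEA_class scale bracket a \<oplus>\<^bsub>UEA scale bracket\<^esub> UEA_class scale bracket b = UEA_class scale bracket (a + b)"
  "UEA_class scale bracket a \<otimes>\<^bsub>UEA scale bracket\<^esub> UEA_class scale bracket b = UEA_class scale bracket (a * b)"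
  "\<zero>\<^bsub>UEA scale bracket\<^esub> = UEA_class scale bracket 0"
  "UEA_class scale bracket a [^]\<^bsub>UEA scale bracket\<^esub> (n::nat) = UEA_class scale bracket (a ^ n)"
  "UEA_scale scale bracket c (UEA_class scale bracket a) = UEA_class scale bracket (const c * a)"
  "UEA_commutator scale bracket (UEA_class scale bracket a) (UEA_class scale bracket b) =
    UEA_class scale bracket (a * b - b * a)"
proof -
  interpret h: ring_hom_ring free_alg_ring "UEA scale bracket" "UEA_class scale bracket"
    by (rule UEA_hom)
  have [simp]: "carrier free_alg_ring = UNIV" by (simp add: free_alg_ring_def)
  show add: "UEA_class scale bracket a \<oplus>\<^bsub>UEA scale bracket\<^esub> UEA_class scale bracket b =
      UEA_class scale bracket (a + b)" for a b
    using h.hom_add[of a b] by (simp add: free_alg_ring_def)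
  show mult: "UEA_class scale bracket a \<otimes>\<^bsub>UEA scale bracket\<^esub> UEA_class scale bracket b =
      UEA_class scale bracket (a * b)" for a b
    using h.hom_mult[of a b] by (simp add: free_alg_ring_def)
  show "\<zero>\<^bsub>UEA scale bracket\<^esub> = UEA_class scale bracket 0"
    using h.hom_zero by (simp add: free_alg_ring_def)
  have one: "\<one>\<^bsub>UEA scale bracket\<^esub> = UEA_class scale bracket 1"
    using h.hom_one by (simp add: free_alg_ring_def)
  show "UEA_class scale bracket a [^]\<^bsub>UEA scale bracket\<^esub> n = UEA_class scale bracket (a ^ n)"
    by (induction n) (simp_all add: one mult power_commutes)
  show "UEA_scale scale bracket c (UEA_class scale bracket a) = UEA_class scale bracket (const c * a)"
    by (simp add: UEA_scale_def mult)
  have neg: "\<ominus>\<^bsub>free_alg_ring\<^esub> x = - x" for x :: "('a, 'k) free_alg"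
    by (rule h.R.minus_equality) (simp_all add: free_alg_ring_def)
  have "\<ominus>\<^bsub>UEA scale bracket\<^esub> UEA_class scale bracket a = UEA_class scale bracket (- a)" for a
    using h.hom_a_inv[of a] by (simp add: neg)
  then show "UEA_commutator scale bracket (UEA_class scale bracket a) (UEA_class scale bracket b) =
      UEA_class scale bracket (a * b - b * a)"
    by (simp add: UEA_commutator_def a_minus_def mult add)
qed

lemma UEA_class_diff_mem:
  assumes "b \<in> UEA_class scale bracket a"
  shows "b - a \<in> enveloping_ideal scale bracket"
  using assms by (auto simp: UEA_class_def a_r_coset_def r_coset_def free_alg_ring_def)

lemma UEA_class_self: "a \<in> UEA_class scale bracket a"
proof -
  have "0 \<in> enveloping_ideal scale bracket"
    using additive_subgroup.zero_closed[OF ideal.axioms(1)[OF ideal_enveloping]]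
    by (simp add: free_alg_ring_def)
  then show ?thesis
    by (force simp: UEA_class_def a_r_coset_def r_coset_def free_alg_ring_def)
qed

end

section \<open>The action of the free algebra on a module and its descent to the quotient\<close>

context lie_module
begin

abbreviation "fa_act \<equiv> free_alg_action scaleM act"

lemma free_alg_action_lincomb: "fa_act a m = lincomb scaleM (\<lambda>w. foldr act (letters w) m) a"
  by (simp add: free_alg_action_def lincomb_def)

lemma foldr_act_add: "foldr act xs (m + m') = foldr act xs m + foldr act xs m'"
  and foldr_act_scale: "foldr act xs (scaleM c m) = scaleM c (foldr act xs m)"
  by (induction xs) simp_all

lemma fa_act_add_left: "fa_act (a + b) m = fa_act a m + fa_act b m"
  and fa_act_diff_left: "fa_act (a - b) m = fa_act a m - fa_act b m"
  and fa_act_zero_left: "fa_act 0 m = 0"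
  and fa_act_const_mult: "fa_act (const c * a) m = scaleM c (fa_act a m)"
  by (simp_all add: free_alg_action_lincomb M.lincomb_add M.lincomb_diff const_def M.lincomb_const_mult)

lemma fa_act_add: "fa_act a (m + m') = fa_act a m + fa_act a m'"
  and fa_act_scale: "fa_act a (scaleM c m) = scaleM c (fa_act a m)"
  by (simp_all add: free_alg_action_def foldr_act_add foldr_act_scale M.scale_right_distrib
      sum.distrib M.scale_sum_right mult.commute)

lemma linear_fa_act: "Vector_Spaces.linear scaleM scaleM (fa_act a)"
  by (simp add: Vector_Spaces.linear_iff M.vector_space_axioms fa_act_add fa_act_scale)

lemma fa_act_gen: "fa_act (gen x) m = act x m"
  by (simp add: free_alg_action_lincomb gen_def)

lemma fa_act_const: "fa_act (const c) m = scaleM c m"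
  by (simp add: free_alg_action_lincomb const_def zero_fword_def)

lemma fa_act_one: "fa_act 1 m = m"
  by (simp add: free_alg_action_lincomb zero_fword_def flip: single_one)

lemma fa_act_mult: "fa_act (a * b) m = fa_act a (fa_act b m)"
proof (induction a rule: poly_mapping_linear_induct)
  case (single v c)
  show ?case
  proof (induction b rule: poly_mapping_linear_induct)
    case (single w c')
    show ?case
      by (simp add: mult_single free_alg_action_lincomb plus_fword_def foldr_act_scale)
  next
    case (add b b')
    then show ?case by (simp add: distrib_left fa_act_add_left fa_act_add)
  next
    case zero
    show ?case using fa_act_scale[of _ 0 0] by (simp add: fa_act_zero_left)
  qed
qed (simp_all add: fa_act_zero_left distrib_right fa_act_add_left)

lemma fa_act_zero: "fa_act a 0 = 0"
  using fa_act_scale[of a 0 0] by simp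

lemma fa_act_power: "fa_act (a ^ n) = fa_act a ^^ n"
  by (induction n) (auto simp: fun_eq_iff fa_act_one fa_act_mult)

text \<open>The elements acting by zero form a two-sided ideal containing the defining
  relations.\<close>

lemma fa_act_enveloping_ideal:
  assumes "a \<in> enveloping_ideal scale bracket"
  shows "fa_act a m = 0"
proof -
  let ?K = "{a. \<forall>m. fa_act a m = 0}"
  have "ideal ?K free_alg_ring"
  proof (rule idealI[OF ring_free_alg_ring])
    have inv: "inv\<^bsub>add_monoid free_alg_ring\<^esub> x = - x" for x :: "('a, 'k) free_alg"
      using abelian_group.minus_equality[OF ring.is_abelian_group[OF ring_free_alg_ring], of "- x" x]
      by (simp add: free_alg_ring_def a_inv_def)
    show "subgroup ?K (add_monoid free_alg_ring)"
    proof (rule subgroup.intro)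
      fix x assume x: "x \<in> ?K"
      have "fa_act (- x) m = 0" for m
        using x fa_act_diff_left[of 0 x m] by (simp add: fa_act_zero_left)
      then show "inv\<^bsub>add_monoid free_alg_ring\<^esub> x \<in> ?K" unfolding inv by blast
    qed (auto simp: free_alg_ring_def fa_act_add_left fa_act_zero_left)
  qed (auto simp: free_alg_ring_def fa_act_mult fa_act_zero)
  moreover have "enveloping_relations scale bracket \<subseteq> ?K"
    by (auto simp: enveloping_relations_def fa_act_diff_left fa_act_add_left fa_act_mult
        fa_act_const fa_act_gen act_bracket)
  ultimately have "enveloping_ideal scale bracket \<subseteq> ?K"
    unfolding enveloping_ideal_def by (intro ring.genideal_minimal[OF ring_free_alg_ring])
  then show ?thesis using assms by blast
qed

lemma UEA_action_class: "UEA_action scaleM act (UEA_class scale bracket a) m = fa_act a m"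
  unfolding UEA_action_def
proof (rule the_equality)
  show "\<forall>b\<in>UEA_class scale bracket a. fa_act b m = fa_act a m"
    using fa_act_enveloping_ideal[OF UEA_class_diff_mem, of _ a m]
    by (simp add: fa_act_diff_left)
  show "v = fa_act a m" if "\<forall>b\<in>UEA_class scale bracket a. fa_act b m = v" for v
    using that UEA_class_self[of a] by auto
qed

end

section \<open>Modules over the p-envelope\<close>

lemma agree_UNIV: "agree UNIV f g \<longleftrightarrow> f = g"
  by (auto simp: agree_def)

text \<open>The module is a parameter so that the locale can serve twice: for the given module and
  for the faithful polynomial module.\<close>

locale envelope_module =
  envelope_comparison scaleL bracketL scaleE bracketE p pmap \<iota> \<phi> +
  LM: lie_module scaleL bracketL scaleM act
  for scaleL :: "'k::field \<Rightarrow> 'a::ab_group_add \<Rightarrow> 'a" and bracketL :: "'a \<Rightarrow> 'a \<Rightarrow> 'a"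
    and scaleE :: "'k \<Rightarrow> 'e::ab_group_add \<Rightarrow> 'e" and bracketE :: "'e \<Rightarrow> 'e \<Rightarrow> 'e"
    and p :: nat and pmap :: "'e \<Rightarrow> 'e" and \<iota> :: "'a \<Rightarrow> 'e"
    and \<phi> :: "'e \<Rightarrow> ('a, 'k) free_alg set"
    and scaleM :: "'k \<Rightarrow> 'm::ab_group_add \<Rightarrow> 'm" and act :: "'a \<Rightarrow> 'm \<Rightarrow> 'm"
begin

abbreviation "cls \<equiv> UEA_class scaleL bracketL"
abbreviation "fa \<equiv> free_alg_action scaleM act"
abbreviation "eact \<equiv> envelope_action scaleM act \<phi>"

lemma phi_class: obtains a where "\<phi> z = cls a"
proof -
  have "UEA_p_subalgebra scaleL bracketL p (range cls)"
    unfolding UEA_p_subalgebra_def L.UEA_carrier by (auto simp: L.UEA_class_simps)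
  then have "\<phi> z \<in> range cls"
    using phi_range[of z] unfolding universal_p_envelope_def
    by (auto simp: UEA_incl_def)
  then show ?thesis using that by blast
qed

lemma eact_class: "\<phi> z = cls a \<Longrightarrow> eact z m = fa a m"
  by (simp add: envelope_action_def LM.UEA_action_class)

lemma eact_iota: "eact (\<iota> x) m = act x m"
  using eact_class[of "\<iota> x" "gen x" m] by (simp add: phi_iota UEA_incl_def LM.fa_act_gen)

sublocale EM: lie_module scaleE bracketE scaleM eact
proof unfold_locales
  fix x y :: 'e and m m' :: 'm and c :: 'k
  obtain a where a: "\<phi> x = cls a" by (rule phi_class)
  obtain b where b: "\<phi> y = cls b" by (rule phi_class)
  show "eact x (m + m') = eact x m + eact x m'" "eact x (scaleM c m) = scaleM c (eact x m)"
    by (simp_all add: eact_class[OF a] LM.fa_act_add LM.fa_act_scale)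
  have "\<phi> (x + y) = cls (a + b)" by (simp add: phi_add a b L.UEA_class_simps)
  then show "eact (x + y) m = eact x m + eact y m"
    by (simp add: eact_class a b LM.fa_act_add_left)
  have "\<phi> (scaleE c x) = cls (const c * a)" by (simp add: phi_scale a L.UEA_class_simps)
  then show "eact (scaleE c x) m = scaleM c (eact x m)"
    by (simp add: eact_class a LM.fa_act_const_mult)
  have "\<phi> (bracketE x y) = cls (a * b - b * a)" by (simp add: phi_bracket a b L.UEA_class_simps)
  then show "eact (bracketE x y) m = eact x (eact y m) - eact y (eact x m)"
    by (simp add: eact_class a b LM.fa_act_diff_left LM.fa_act_mult)
qed

text \<open>Seen through the module, \<open>a\<close> and \<open>w\<close> have the same commutators
  with the envelope. This makes the Lie derivative of \<open>fa a\<close> and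
  \<open>bracketE w\<close> commute with the coboundary.\<close>

definition compat :: "('a, 'k) free_alg \<Rightarrow> 'e \<Rightarrow> bool" where
  "compat a w \<longleftrightarrow> (\<forall>y m. fa a (eact y m) - eact y (fa a m) = eact (bracketE w y) m)"

lemma compat_gen: "compat (gen x) (\<iota> x)"
  by (simp add: compat_def LM.fa_act_gen EM.act_bracket flip: eact_iota)

lemma compat_zero: "compat 0 0"
  by (simp add: compat_def LM.fa_act_zero_left)

lemma compat_add: "compat a w \<Longrightarrow> compat b v \<Longrightarrow> compat (a + b) (w + v)"
  by (simp add: compat_def LM.fa_act_add_left flip: add_diff_eq diff_diff_eq2)
    (simp add: algebra_simps)

lemma compat_scale: "compat a w \<Longrightarrow> compat (const c * a) (scaleE c w)"
  by (simp add: compat_def LM.fa_act_const_mult flip: LM.M.scale_right_diff_distrib)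

lemma compat_commutator:
  assumes "compat a w" "compat b v"
  shows "compat (a * b - b * a) (bracketE w v)"
  unfolding compat_def
proof (intro allI)
  fix y m
  have a: "fa a (eact y m) = eact y (fa a m) + eact (bracketE w y) m" for y m
    using assms(1) by (simp add: compat_def algebra_simps)
  have b: "fa b (eact y m) = eact y (fa b m) + eact (bracketE v y) m" for y m
    using assms(2) by (simp add: compat_def algebra_simps)
  have "bracketE (bracketE w v) y = bracketE w (bracketE v y) - bracketE v (bracketE w y)"
    by (simp add: bracket_derivation[of w])
  then show "fa (a * b - b * a) (eact y m) - eact y (fa (a * b - b * a) m) = eact (bracketE (bracketE w v) y) m"
    by (simp add: LM.fa_act_diff_left LM.fa_act_mult a b LM.fa_act_add)
qed

lemma compat_power:
  assumes "compat a w"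
  shows "compat (a ^ p) (pmap w)"
  unfolding compat_def LM.fa_act_power pmap_bracket
  using LM.M.commutator_power_prime_char[OF LM.linear_fa_act prime_p char_p, of a eact "bracketE w"] assms
  by (simp add: compat_def)

text \<open>Quantifying over all intermediate \<open>S\<close> lets a single closure argument serve
  every step of the chain of extensions.\<close>

definition theta_trivial :: "('a, 'k) free_alg \<Rightarrow> 'e \<Rightarrow> bool" where
  "theta_trivial a w \<longleftrightarrow> (\<forall>S j f. subspace S \<longrightarrow> range \<iota> \<subseteq> S \<longrightarrow> f \<in> EM.CE_cochains j \<longrightarrow>
     agree S (EM.CE_d j f) 0 \<longrightarrow> EM.rel_exact S j (lie_der (fa a) (bracketE w) f))"

lemma theta_trivialI:
  assumes "\<And>S j f. subspace S \<Longrightarrow> range \<iota> \<subseteq> S \<Longrightarrow> f \<in> EM.CE_cochains j \<Longrightarrow>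
    agree S (EM.CE_d j f) 0 \<Longrightarrow> EM.rel_exact S j (lie_der (fa a) (bracketE w) f)"
  shows "theta_trivial a w"
  using assms by (simp add: theta_trivial_def)

lemma theta_trivialD:
  "theta_trivial a w \<Longrightarrow> subspace S \<Longrightarrow> range \<iota> \<subseteq> S \<Longrightarrow> f \<in> EM.CE_cochains j \<Longrightarrow>
    agree S (EM.CE_d j f) 0 \<Longrightarrow> EM.rel_exact S j (lie_der (fa a) (bracketE w) f)"
  by (simp add: theta_trivial_def)

lemma theta_trivial_gen: "theta_trivial (gen x) (\<iota> x)"
proof (rule theta_trivialI)
  fix S j f
  assume "range \<iota> \<subseteq> S" "f \<in> EM.CE_cochains j" "agree S (EM.CE_d j f) 0"
  moreover have "fa (gen x) = eact (\<iota> x)"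
    by (rule ext) (simp add: LM.fa_act_gen eact_iota)
  ultimately show "EM.rel_exact S j (lie_der (fa (gen x)) (bracketE (\<iota> x)) f)"
    using EM.theta_rel_cocycle[of f j S "\<iota> x"] by auto
qed

lemma rel_exact_add:
  assumes "EM.rel_exact S j f" "EM.rel_exact S j g"
  shows "EM.rel_exact S j (f + g)"
proof (cases j)
  case 0
  then show ?thesis using assms agree_add[of S f 0 g 0] by (simp add: EM.rel_exact_def)
next
  case (Suc k)
  obtain u v where u: "u \<in> EM.CE_cochains k" "agree S f (EM.CE_d k u)"
    and v: "v \<in> EM.CE_cochains k" "agree S g (EM.CE_d k v)"
    using assms by (auto simp: EM.rel_exact_def Suc)
  show ?thesis
    using agree_add[OF u(2) v(2)] EM.pair.cochains_add[OF u(1) v(1)]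
    by (auto simp: EM.rel_exact_def Suc simp flip: EM.coboundary_add)
qed

lemma rel_exact_scale:
  assumes "EM.rel_exact S j f"
  shows "EM.rel_exact S j (\<lambda>xs. scaleM c (f xs))"
proof (cases j)
  case 0
  then show ?thesis using assms by (simp add: EM.rel_exact_def agree_def)
next
  case (Suc k)
  obtain u where u: "u \<in> EM.CE_cochains k" "agree S f (EM.CE_d k u)"
    using assms by (auto simp: EM.rel_exact_def Suc)
  have "agree S (\<lambda>xs. scaleM c (f xs)) (EM.CE_d k (\<lambda>xs. scaleM c (u xs)))"
    using u(2) by (simp add: EM.coboundary_scale agree_def)
  then show ?thesis
    using EM.pair.cochains_scale[OF u(1)] by (auto simp: EM.rel_exact_def Suc)
qed

text \<open>\<open>S\<close> contains all brackets, so it is stable under \<open>bracketE w\<close>,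
  and by compatibility the operator commutes with the coboundary. Operators can therefore be
  composed on the cohomology of \<open>S\<close>.\<close>

lemma rel_exact_lie_der:
  assumes S: "range \<iota> \<subseteq> S" and "compat a w" and f: "EM.rel_exact S j f"
  shows "EM.rel_exact S j (lie_der (fa a) (bracketE w) f)"
proof -
  have w: "bracketE w ` S \<subseteq> S" using bracket_in_range_iota S by blast
  show ?thesis
  proof (cases j)
    case 0
    then have "agree S (lie_der (fa a) (bracketE w) f) (lie_der (fa a) (bracketE w) 0)"
      using f by (intro agree_lie_der w) (simp add: EM.rel_exact_def)
    then show ?thesis by (simp add: EM.rel_exact_def 0 agree_def lie_der_def LM.fa_act_zero)
  next
    case (Suc k)
    obtain u where u: "u \<in> EM.CE_cochains k" "agree S f (EM.CE_d k u)"
      using f by (auto simp: EM.rel_exact_def Suc)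
    have "agree S (lie_der (fa a) (bracketE w) f) (lie_der (fa a) (bracketE w) (EM.CE_d k u))"
      by (rule agree_lie_der[OF u(2) w])
    also have "lie_der (fa a) (bracketE w) (EM.CE_d k u) = EM.CE_d k (lie_der (fa a) (bracketE w) u)"
      using assms(2)
      by (intro EM.lie_der_coboundary u LM.linear_fa_act EM.linear_ad)
        (simp_all add: compat_def bracket_derivation[of w])
    finally show ?thesis
      using EM.pair.cochain_lie_der[OF u(1) LM.linear_fa_act EM.linear_ad]
      by (auto simp: EM.rel_exact_def Suc)
  qed
qed

lemma theta_trivial_add:
  assumes "theta_trivial a w" "theta_trivial b v"
  shows "theta_trivial (a + b) (w + v)"
proof (rule theta_trivialI)
  fix S j f
  assume h: "subspace S" "range \<iota> \<subseteq> S" and f: "f \<in> EM.CE_cochains j" and df: "agree S (EM.CE_d j f) 0"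
  have "lie_der (fa (a + b)) (bracketE (w + v)) f =
      lie_der (fa a) (bracketE w) f + lie_der (fa b) (bracketE v) f"
    by (rule ext) (simp add: lie_der_def LM.fa_act_add_left upd_conv_take_nth_drop
        EM.pair.cochain_add[OF f] sum.distrib)
  then show "EM.rel_exact S j (lie_der (fa (a + b)) (bracketE (w + v)) f)"
    using rel_exact_add theta_trivialD[OF assms(1) h f df] theta_trivialD[OF assms(2) h f df] by simp
qed

lemma theta_trivial_scale:
  assumes "theta_trivial a w"
  shows "theta_trivial (const c * a) (scaleE c w)"
proof (rule theta_trivialI)
  fix S j f
  assume h: "subspace S" "range \<iota> \<subseteq> S" and f: "f \<in> EM.CE_cochains j" and df: "agree S (EM.CE_d j f) 0"
  have "lie_der (fa (const c * a)) (bracketE (scaleE c w)) f =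
      (\<lambda>xs. scaleM c (lie_der (fa a) (bracketE w) f xs))"
    by (rule ext) (simp add: lie_der_def LM.fa_act_const_mult upd_conv_take_nth_drop
        EM.pair.cochain_scale[OF f] LM.M.scale_right_diff_distrib LM.M.scale_sum_right)
  then show "EM.rel_exact S j (lie_der (fa (const c * a)) (bracketE (scaleE c w)) f)"
    using rel_exact_scale theta_trivialD[OF assms h f df] by simp
qed

lemma theta_trivial_zero: "theta_trivial 0 0"
  using theta_trivial_scale[OF theta_trivial_gen, of 0 0] by (simp add: const_def)

text \<open>The operator of a commutator is the commutator of the operators. In each product the
  factor applied first already yields an exact form, and the other keeps it exact.\<close>

lemma theta_trivial_commutator:
  assumes "theta_trivial a w" "theta_trivial b v" "compat a w" "compat b v"
  shows "theta_trivial (a * b - b * a) (bracketE w v)"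
proof (rule theta_trivialI)
  fix S j f
  assume h: "subspace S" "range \<iota> \<subseteq> S" and f: "f \<in> EM.CE_cochains j" and df: "agree S (EM.CE_d j f) 0"
  let ?A = "lie_der (fa a) (bracketE w)" and ?B = "lie_der (fa b) (bracketE v)"
  have "fa (a * b - b * a) = (\<lambda>m. fa a (fa b m) - fa b (fa a m))"
    by (rule ext) (simp add: LM.fa_act_diff_left LM.fa_act_mult)
  moreover have "bracketE (bracketE w v) = (\<lambda>x. bracketE w (bracketE v x) - bracketE v (bracketE w x))"
    by (rule ext) (simp add: bracket_derivation[of w])
  ultimately have "lie_der (fa (a * b - b * a)) (bracketE (bracketE w v)) f = ?A (?B f) - ?B (?A f)"
    using EM.pair.lie_der_commutator[OF f LM.linear_fa_act[of a] LM.linear_fa_act[of b] EM.linear_ad[of w] EM.linear_ad[of v]]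
    by simp
  also have "\<dots> = ?A (?B f) + (\<lambda>xs. scaleM (- 1) (?B (?A f) xs))"
    by (rule ext) simp
  finally show "EM.rel_exact S j (lie_der (fa (a * b - b * a)) (bracketE (bracketE w v)) f)"
    using rel_exact_lie_der[OF h(2) assms(3) theta_trivialD[OF assms(2) h f df]]
      rel_exact_lie_der[OF h(2) assms(4) theta_trivialD[OF assms(1) h f df]]
    by (simp only: rel_exact_add rel_exact_scale)
qed

text \<open>The operator of the p-th powers is the p-fold iterate. Its first application gives an
  exact form, and the remaining ones preserve exactness.\<close>

lemma theta_trivial_power:
  assumes "theta_trivial a w" "compat a w"
  shows "theta_trivial (a ^ p) (pmap w)"
proof (rule theta_trivialI)
  fix S j f
  assume h: "subspace S" "range \<iota> \<subseteq> S" and f: "f \<in> EM.CE_cochains j" and df: "agree S (EM.CE_d j f) 0"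
  have "EM.rel_exact S j ((lie_der (fa a) (bracketE w) ^^ Suc m) f)" for m
  proof (induction m)
    case 0
    then show ?case using theta_trivialD[OF assms(1) h f df] by simp
  next
    case (Suc m)
    then show ?case using rel_exact_lie_der[OF h(2) assms(2)] by (simp only: funpow.simps o_apply)
  qed
  then have "EM.rel_exact S j ((lie_der (fa a) (bracketE w) ^^ p) f)" by (metis p_Suc)
  then show "EM.rel_exact S j (lie_der (fa (a ^ p)) (bracketE (pmap w)) f)"
    by (simp add: LM.M.lie_der_power_prime_char[OF LM.linear_fa_act prime_p char_p] LM.fa_act_power pmap_ad)
qed

text \<open>Closure under the operations of a p-subalgebra provides for \<open>\<phi> z\<close> a
  partner \<open>w\<close> with trivial operator. The faithful module then shows that
  \<open>z\<close> and \<open>w\<close> have the same adjoint map.\<close>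

lemma theta_trivial_eact:
  assumes V: "envelope_module scaleL bracketL scaleE bracketE p pmap \<iota> \<phi> scaleV actV"
    and faithful: "\<And>x. (\<And>v. actV x v = 0) \<Longrightarrow> x = 0"
    and S: "subspace S" "range \<iota> \<subseteq> S" and f: "f \<in> EM.CE_cochains j" "agree S (EM.CE_d j f) 0"
  shows "EM.rel_exact S j (EM.CE_theta z f)"
proof -
  interpret V: envelope_module scaleL bracketL scaleE bracketE p pmap \<iota> \<phi> scaleV actV by (rule V)
  \<comment> \<open>Compatibility is demanded on both modules: on the given one it makes the
    operators commute with the coboundary, on the faithful one it determines the adjoint map of
    \<open>w\<close>.\<close>
  let ?good = "\<lambda>a w. compat a w \<and> V.compat a w \<and> theta_trivial a w"
  let ?G = "{cls a | a. \<exists>w. ?good a w}"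
  have "UEA_p_subalgebra scaleL bracketL p ?G"
    unfolding UEA_p_subalgebra_def
  proof (intro conjI ballI allI)
    show "?G \<subseteq> carrier (UEA scaleL bracketL)" by (auto simp: L.UEA_carrier)
    show "\<zero>\<^bsub>UEA scaleL bracketL\<^esub> \<in> ?G"
      using compat_zero V.compat_zero theta_trivial_zero by (auto simp: L.UEA_class_simps)
    fix u assume "u \<in> ?G"
    then obtain a w where u: "u = cls a" "?good a w" by blast
    have "?good (const c * a) (scaleE c w)" for c
      using u compat_scale V.compat_scale theta_trivial_scale by blast
    then show "UEA_scale scaleL bracketL c u \<in> ?G" for c
      unfolding u(1) L.UEA_class_simps by blast
    have "?good (a ^ p) (pmap w)"
      using u compat_power V.compat_power theta_trivial_power by blast
    then show "u [^]\<^bsub>UEA scaleL bracketL\<^esub> p \<in> ?G"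
      unfolding u(1) L.UEA_class_simps by blast
    fix u' assume "u' \<in> ?G"
    then obtain b v where u': "u' = cls b" "?good b v" by blast
    have "?good (a + b) (w + v)"
      using u u' compat_add V.compat_add theta_trivial_add by blast
    then show "u \<oplus>\<^bsub>UEA scaleL bracketL\<^esub> u' \<in> ?G"
      unfolding u(1) u'(1) L.UEA_class_simps by blast
    have "?good (a * b - b * a) (bracketE w v)"
      using u u' compat_commutator V.compat_commutator theta_trivial_commutator by blast
    then show "UEA_commutator scaleL bracketL u u' \<in> ?G"
      unfolding u(1) u'(1) L.UEA_class_simps by blast
  qed
  moreover have "range (UEA_incl scaleL bracketL) \<subseteq> ?G"
    unfolding UEA_incl_def using compat_gen V.compat_gen theta_trivial_gen by blast
  ultimately have "\<phi> z \<in> ?G"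
    using phi_range[of z] unfolding universal_p_envelope_def by blast
  then obtain a w where a: "\<phi> z = cls a" and good: "?good a w" by blast
  have ad: "bracketE z = bracketE w"
  proof
    fix y
    \<comment> \<open>The bracket lies in the image of L and acts by zero on the faithful module by
      compatibility, so it vanishes.\<close>
    have "bracketE (z - w) (\<iota> x) = 0" for x
    proof -
      obtain x' where x': "bracketE (z - w) (\<iota> x) = \<iota> x'"
        using bracket_in_range_iota by blast
      have "actV x' v = 0" for v
      proof -
        have "V.eact (bracketE w (\<iota> x)) v = V.eact (bracketE z (\<iota> x)) v"
          using good V.eact_class[OF a] by (simp add: V.compat_def V.EM.act_bracket)
        then have "V.eact (bracketE (z - w) (\<iota> x)) v = 0" by simp
        then show ?thesis by (simp only: x' V.eact_iota)
      qed
      then have "x' = 0" by (rule faithful)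
      then show ?thesis unfolding x' by (simp add: iota_simps)
    qed
    then have "bracketE (z - w) y = 0" by (rule centralizer_range_iota)
    then show "bracketE z y = bracketE w y" by simp
  qed
  have "eact z = fa a" by (rule ext) (rule eact_class[OF a])
  then show ?thesis using theta_trivialD[OF _ S f, of a w] good by (simp add: ad)
qed

text \<open>Vectors of \<open>B\<close> are adjoined one at a time; each either lies in the span
  already or gives an extension of codimension one.\<close>

lemma rel_vanishes_span:
  assumes triv: "\<And>S j f z. subspace S \<Longrightarrow> range \<iota> \<subseteq> S \<Longrightarrow> f \<in> EM.CE_cochains j \<Longrightarrow>
      agree S (EM.CE_d j f) 0 \<Longrightarrow> EM.rel_exact S j (EM.CE_theta z f)"
    and "finite B"
  shows "(\<forall>j\<le>n. EM.rel_vanishes (range \<iota>) j) \<longleftrightarrow>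
    (\<forall>j\<le>n. EM.rel_vanishes (span (range \<iota> \<union> B)) j)"
  using assms(2)
proof (induction B rule: finite_induct)
  case empty
  have span: "span (range \<iota>) = range \<iota>" using subspace_range_iota by simp
  show ?case unfolding Un_empty_right span ..
next
  case (insert b B)
  let ?S = "span (range \<iota> \<union> B)" and ?T = "span (insert b (range \<iota> \<union> B))"
  have I: "range \<iota> \<subseteq> ?S" "range \<iota> \<subseteq> ?T"
    using span_superset[of "range \<iota> \<union> B"] span_superset[of "insert b (range \<iota> \<union> B)"] by simp_all
  have "(\<forall>j\<le>n. EM.rel_vanishes ?S j) \<longleftrightarrow> (\<forall>j\<le>n. EM.rel_vanishes ?T j)"
  proof (cases "b \<in> ?S")
    case True
    then show ?thesis by (simp add: span_redundant)
  next
    case False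
    interpret K: vector_space "(*) :: 'k \<Rightarrow> 'k \<Rightarrow> 'k" by unfold_locales (simp_all add: algebra_simps)
    interpret EK: vector_space_pair scaleE "(*) :: 'k \<Rightarrow> 'k \<Rightarrow> 'k" by unfold_locales
    \<comment> \<open>\<open>C\<close> is a basis of \<open>?S\<close> and stays independent when
      \<open>b\<close> is added, so some functional is 1 on \<open>b\<close> and 0 on
      \<open>?S\<close>.\<close>
    obtain C where C: "C \<subseteq> ?S" "independent C" "?S \<subseteq> span C"
      using maximal_independent_subset[of ?S] by metis
    have "span C \<subseteq> ?S" using C(1) by (simp add: span_minimal)
    then have bC: "b \<notin> span C" using False by blast
    then have ind: "independent (insert b C)" using C(2) by (simp add: independent_insertI)
    obtain l where l: "Vector_Spaces.linear scaleE (*) l" "\<forall>x\<in>insert b C. l x = (if x = b then 1 else 0)"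
      using EK.linear_independent_extend[OF ind, of "\<lambda>x. if x = b then 1 else 0"] by blast
    have "b \<notin> C" using bC span_base by blast
    then have "l x = 0" if "x \<in> C" for x using l(2) that by auto
    then have lS: "l x = 0" if "x \<in> ?S" for x
      using EK.linear_eq_0_on_span[OF l(1)] C(3) that by blast
    show ?thesis
    proof (rule EM.rel_vanishes_codim_one[where z = b and l = l])
      \<comment> \<open>Both subspaces contain every bracket, hence are ideals.\<close>
      show "EM.bracket_closed ?S" "bracketE b ` ?S \<subseteq> ?S" "EM.bracket_closed ?T"
        using bracket_in_range_iota I by (auto simp: EM.bracket_closed_def)
      show "?T = {s + scaleE c b | s c. s \<in> ?S}"
      proof (intro equalityI subsetI)
        fix x assume "x \<in> ?T"
        then obtain c where "x - scaleE c b \<in> ?S" unfolding span_insert by blast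
        moreover have "x = (x - scaleE c b) + scaleE c b" by simp
        ultimately show "x \<in> {s + scaleE c b | s c. s \<in> ?S}" by blast
      next
        fix x assume "x \<in> {s + scaleE c b | s c. s \<in> ?S}"
        then obtain s c where "x = s + scaleE c b" "s \<in> ?S" by blast
        then have "x - scaleE c b \<in> ?S" by simp
        then show "x \<in> ?T" unfolding span_insert by blast
      qed
      show "EM.rel_exact ?S j (EM.CE_theta b f)"
        if "f \<in> EM.CE_cochains j" "agree ?S (EM.CE_d j f) 0" for j f
        using triv[OF subspace_span I(1) that] .
    qed (use l lS span_zero in simp_all)
  qed
  then show ?case using insert.IH by simp
qed

end

section \<open>Relative vanishing compared with actual cohomology\<close>

context lie_module
begin

lemma coboundaries_closed:
  assumes "f \<in> coboundaries scale bracket scaleM act j" "g \<in> coboundaries scale bracket scaleM act j"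
  shows "f - g \<in> coboundaries scale bracket scaleM act j"
  using assms pair.cochains_diff
  by (auto simp: coboundaries_def split: nat.splits simp flip: coboundary_diff)

lemma zero_coboundaries: "0 \<in> coboundaries scale bracket scaleM act j"
  using pair.cochains_zero coboundary_zero by (force simp: coboundaries_def split: nat.splits)

lemma cohomology_vanishes_iff:
  "cohomology_vanishes scale bracket scaleM act j \<longleftrightarrow>
    cocycles scale bracket scaleM act j \<subseteq> coboundaries scale bracket scaleM act j"
proof -
  let ?B = "coboundaries scale bracket scaleM act j" and ?Z = "cocycles scale bracket scaleM act j"
  have Z: "0 \<in> ?Z" by (simp add: cocycles_def pair.cochains_zero coboundary_zero)
  have B: "coset ?B f = coset ?B 0 \<longleftrightarrow> f \<in> ?B" for f
  proof
    assume "coset ?B f = coset ?B 0"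
    moreover have "f \<in> coset ?B f" using zero_coboundaries by (force simp: coset_def)
    ultimately show "f \<in> ?B" by (auto simp: coset_def)
  next
    assume f: "f \<in> ?B"
    have add: "f + w \<in> ?B" if "w \<in> ?B" for w
      using coboundaries_closed[OF f coboundaries_closed[OF zero_coboundaries that]] by simp
    show "coset ?B f = coset ?B 0"
    proof (intro equalityI subsetI)
      fix x assume "x \<in> coset ?B f"
      then obtain w where "x = 0 + (f + w)" "f + w \<in> ?B" using add by (auto simp: coset_def)
      then show "x \<in> coset ?B 0" unfolding coset_def by blast
    next
      fix x assume "x \<in> coset ?B 0"
      then have "x = f + (x - f)" "x - f \<in> ?B"
        using coboundaries_closed[OF _ f] by (auto simp: coset_def)
      then show "x \<in> coset ?B f" unfolding coset_def by blast
    qed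
  qed
  show ?thesis
    unfolding cohomology_vanishes_def cohomology_def quotient_space_def using Z B by auto
qed

lemma rel_vanishes_UNIV:
  "rel_vanishes UNIV j \<longleftrightarrow> cohomology_vanishes scale bracket scaleM act j"
  unfolding cohomology_vanishes_iff rel_vanishes_def rel_exact_def cocycles_def coboundaries_def
    agree_UNIV
  by (auto split: nat.splits)

end

lemma cochain_compose_linear:
  assumes f: "f \<in> cochains s1 s2 n" and h: "Vector_Spaces.linear s0 s1 h"
    and "vector_space s2"
  shows "f \<circ> map h \<in> cochains s0 s2 n"
proof -
  interpret h: Vector_Spaces.linear s0 s1 h by (rule h)
  interpret s2: vector_space s2 by fact
  interpret V0: vector_space_pair s0 s2 by unfold_locales
  interpret V1: vector_space_pair s1 s2 by unfold_locales
  show ?thesis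
    using f unfolding V0.cochains_iff V1.cochains_iff V0.linear_iff V1.linear_iff
    by (simp add: h.add h.scale)
qed

context envelope_module
begin

lemma coboundary_compose_iota: "EM.CE_d n f \<circ> map \<iota> = LM.CE_d n (f \<circ> map \<iota>)"
  by (rule ext) (simp add: coboundary_def eact_iota iota_bracket nths_map)

lemma agree_range_iota: "agree (range \<iota>) f g \<longleftrightarrow> f \<circ> map \<iota> = g \<circ> map \<iota>"
proof -
  have "map \<iota> (map (inv_into UNIV \<iota>) xs) = xs" if "set xs \<subseteq> range \<iota>" for xs
    using that by (induction xs) (auto simp: f_inv_into_f)
  moreover have "set (map \<iota> ys) \<subseteq> range \<iota>" for ys by auto
  ultimately show ?thesis unfolding agree_def fun_eq_iff o_apply by metis
qed

text \<open>A linear left inverse of \<open>\<iota>\<close> extends every cochain of L to the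
  envelope. Restriction of cochains is thus onto, and it commutes with the coboundaries.\<close>

lemma rel_vanishes_range_iota:
  "EM.rel_vanishes (range \<iota>) j \<longleftrightarrow> cohomology_vanishes scaleL bracketL scaleM act j"
proof -
  interpret LE: vector_space_pair scaleL scaleE by unfold_locales
  obtain \<pi> where pi: "Vector_Spaces.linear scaleE scaleL \<pi>" "\<pi> \<circ> \<iota> = id"
    using LE.linear_injective_left_inverse[OF iota_linear iota_inj] by blast
  have down: "f \<circ> map \<iota> \<in> LM.CE_cochains n" if "f \<in> EM.CE_cochains n" for f n
    using cochain_compose_linear[OF that iota_linear LM.M.vector_space_axioms] .
  have up: "g \<circ> map \<pi> \<in> EM.CE_cochains n" if "g \<in> LM.CE_cochains n" for g n
    using cochain_compose_linear[OF that pi(1) LM.M.vector_space_axioms] .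
  have inv: "g \<circ> map \<pi> \<circ> map \<iota> = g" for g :: "'a list \<Rightarrow> 'm"
    by (simp add: o_assoc[symmetric] pi)
  have zero: "0 \<circ> map \<iota> = (0 :: 'a list \<Rightarrow> 'm)" by (rule ext) simp
  have exact: "EM.rel_exact (range \<iota>) j f \<longleftrightarrow> LM.rel_exact UNIV j (f \<circ> map \<iota>)" for f
  proof (cases j)
    case 0
    then show ?thesis
      by (simp add: EM.rel_exact_def LM.rel_exact_def agree_range_iota agree_UNIV zero)
  next
    case (Suc k)
    have "(\<exists>g\<in>EM.CE_cochains k. f \<circ> map \<iota> = LM.CE_d k (g \<circ> map \<iota>)) \<longleftrightarrow>
        (\<exists>g\<in>LM.CE_cochains k. f \<circ> map \<iota> = LM.CE_d k g)"
      using down up inv by metis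
    then show ?thesis
      by (simp add: EM.rel_exact_def LM.rel_exact_def agree_range_iota agree_UNIV
          coboundary_compose_iota Suc)
  qed
  have "EM.rel_vanishes (range \<iota>) j \<longleftrightarrow> LM.rel_vanishes UNIV j"
  proof -
    have "EM.rel_vanishes (range \<iota>) j \<longleftrightarrow> (\<forall>f\<in>EM.CE_cochains j.
        LM.CE_d j (f \<circ> map \<iota>) = 0 \<longrightarrow> LM.rel_exact UNIV j (f \<circ> map \<iota>))"
      by (simp add: EM.rel_vanishes_def agree_range_iota coboundary_compose_iota exact zero)
    also have "\<dots> \<longleftrightarrow> (\<forall>g\<in>LM.CE_cochains j. LM.CE_d j g = 0 \<longrightarrow> LM.rel_exact UNIV j g)"
      using down up inv by metis
    also have "\<dots> \<longleftrightarrow> LM.rel_vanishes UNIV j"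
      by (simp add: LM.rel_vanishes_def agree_UNIV)
    finally show ?thesis .
  qed
  then show ?thesis by (simp add: LM.rel_vanishes_UNIV)
qed

lemma span_range_iota_UNIV:
  assumes "finite_dimensional_quotient scaleE UNIV (range \<iota>)"
  obtains B where "finite B" "span (range \<iota> \<union> B) = UNIV"
proof -
  obtain B where B: "finite B" and q: "quotient_space UNIV (range \<iota>) =
      {coset (range \<iota>) (\<Sum>b\<in>B. scaleE (c b) b) | c. True}"
    using assms by (auto simp: finite_dimensional_quotient_def)
  have "x \<in> span (range \<iota> \<union> B)" for x
  proof -
    have "coset (range \<iota>) x \<in> {coset (range \<iota>) (\<Sum>b\<in>B. scaleE (c b) b) | c. True}"
      unfolding q[symmetric] quotient_space_def by blast
    then obtain c where c: "coset (range \<iota>) x = coset (range \<iota>) (\<Sum>b\<in>B. scaleE (c b) b)" by blast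
    have "x + 0 \<in> coset (range \<iota>) x"
      using subspace_0[OF subspace_range_iota] unfolding coset_def by blast
    then obtain w where "w \<in> range \<iota>" "x = (\<Sum>b\<in>B. scaleE (c b) b) + w"
      unfolding c by (auto simp: coset_def)
    then show ?thesis
      by (auto intro!: span_add span_sum span_scale intro: span_base)
  qed
  then show ?thesis using that B by blast
qed

lemma cohomology_vanishes_iff_envelope:
  assumes "\<exists>B. finite_dimensional_vector_space scaleL B"
    and "finite_dimensional_quotient scaleE UNIV (range \<iota>)"
  shows "(\<forall>j\<le>n. cohomology_vanishes scaleL bracketL scaleM act j) \<longleftrightarrow>
    (\<forall>j\<le>n. cohomology_vanishes scaleE bracketE scaleM eact j)"
proof -
  obtain B where "finite_dimensional_vector_space scaleL B" using assms(1) by blast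
  then interpret LB: finite_dimensional_vector_space scaleL B .
  obtain e where e: "bij_betw e {..<card B} B"
    using ex_bij_betw_nat_finite[OF LB.finite_Basis] by (auto simp: atLeast0LessThan)
  interpret P: lie_algebra_basis scaleL bracketL e "card B"
    using e LB.independent_Basis LB.span_Basis
    by unfold_locales (auto simp: bij_betw_def)
  interpret V: lie_module scaleL bracketL pbw_scale P.pbw_act by (rule P.pbw_lie_module)
  have V: "envelope_module scaleL bracketL scaleE bracketE p pmap \<iota> \<phi> pbw_scale P.pbw_act"
    by unfold_locales
  obtain C where C: "finite C" "span (range \<iota> \<union> C) = UNIV"
    using span_range_iota_UNIV[OF assms(2)] .
  have "(\<forall>j\<le>n. EM.rel_vanishes (range \<iota>) j) \<longleftrightarrow> (\<forall>j\<le>n. EM.rel_vanishes UNIV j)"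
    unfolding C(2)[symmetric]
    by (rule rel_vanishes_span[OF theta_trivial_eact[OF V] C(1)]) (rule P.pbw_act_one_eq_0)
  then show ?thesis
    by (simp add: rel_vanishes_range_iota EM.rel_vanishes_UNIV)
qed

end

theorem corollary2p5:
  fixes scaleL :: "'k::field \<Rightarrow> 'a::ab_group_add \<Rightarrow> 'a"
    and bracketL :: "'a \<Rightarrow> 'a \<Rightarrow> 'a"
    and scaleM :: "'k \<Rightarrow> 'm::ab_group_add \<Rightarrow> 'm"
    and act :: "'a \<Rightarrow> 'm \<Rightarrow> 'm"
    and scaleE :: "'k \<Rightarrow> 'e::ab_group_add \<Rightarrow> 'e"
    and bracketE :: "'e \<Rightarrow> 'e \<Rightarrow> 'e"
    and pmap :: "'e \<Rightarrow> 'e"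
    and \<iota> :: "'a \<Rightarrow> 'e"
    and \<phi> :: "'e \<Rightarrow> ('a, 'k) free_alg set"
    and p n :: nat
  assumes "prime p" and "CHAR('k) = p"
    and "lie_algebra scaleL bracketL"
    and "\<exists>B. finite_dimensional_vector_space scaleL B"
    and "lie_module scaleL bracketL scaleM act"
    and "\<exists>B. finite_dimensional_vector_space scaleM B"
    and "p_envelope scaleL bracketL scaleE bracketE p pmap \<iota>"
    and "finite_dimensional_quotient scaleE UNIV (range \<iota>)"
    and "envelope_comparison scaleL bracketL scaleE bracketE p pmap \<iota> \<phi>"
  shows "((\<forall>j\<le>n. cohomology_vanishes scaleL bracketL scaleM act j) \<longleftrightarrow>
          (\<forall>j\<le>n. cohomology_vanishes scaleE bracketE scaleM (envelope_action scaleM act \<phi>) j))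
       \<and> ((\<forall>j. cohomology_vanishes scaleL bracketL scaleM act j) \<longleftrightarrow>
          (\<forall>j. cohomology_vanishes scaleE bracketE scaleM (envelope_action scaleM act \<phi>) j))"
proof -
  interpret envelope_module scaleL bracketL scaleE bracketE p pmap \<iota> \<phi> scaleM act
    using assms(5,9) by (rule envelope_module.intro[rotated])
  note main = cohomology_vanishes_iff_envelope[OF assms(4,8)]
  \<comment> \<open>The equivalence for all degrees follows by using \<open>main\<close> at each
    degree \<open>j\<close> as upper bound.\<close>
  show ?thesis using main by (meson order_refl)
qed

end
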